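(* Fix an integer $n>2$. Let $c$ be a nonzero square-free integer with $c\ne\pm1$. For $d\in\mathbb{Z}$ let $g_d(x)=x^n+cx^{n-1}+cd$, and consider those $d$ for which $g_d$ is irreducible, with $\theta_d$ a root of $g_d$. Let \[B=\frac{6}{\pi^2}\prod_{p\mid c}\frac{p}{p+1}-\left(1-\frac{6}{\pi^2}\prod_{p\mid n}\frac{p^2}{p^2-1}\right),\] where the products run over primes. Then $B$ is a lower bound on the natural density of the set of integers $d$ such that $\mathbb{Z}[\theta_d]$ is the full ring of integers of $\mathbb{Q}(\theta_d)$. In particular, if $c$ has exactly one prime factor, or $c$ has exactly two prime factors and is coprime to $6$, then $B>0$ and there are infinitely many such $d$.
   Context: For a set $A$ of integers, its natural density is $\lim_{x\to\infty}\#\{a\in A: a\le x\}/x$ (taken over the relevant counting of integers); "$B$ is a lower bound on the density" means this proportion is asymptotically at least $B$. *)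

theory Defs
  imports "HOL-Computational_Algebra.Computational_Algebra" Complex_Main
begin

definition gpoly :: "nat \<Rightarrow> int \<Rightarrow> int \<Rightarrow> int poly" where
  "gpoly n c d = monom 1 n + monom c (n - 1) + [:c * d:]"

definition Zadj :: "complex \<Rightarrow> complex set" where
  "Zadj \<theta> = {poly (map_poly of_int p) \<theta> | p :: int poly. True}"

definition Qadj :: "complex \<Rightarrow> complex set" where
  "Qadj \<theta> = {poly (map_poly of_rat p) \<theta> / poly (map_poly of_rat q) \<theta> | p q :: rat poly.
                 poly (map_poly of_rat q) \<theta> \<noteq> 0}"

definition ring_of_integers :: "complex set \<Rightarrow> complex set" where
  "ring_of_integers K = {x \<in> K. algebraic_int x}"

definition monogenic_d :: "nat \<Rightarrow> int \<Rightarrow> int set" where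
  "monogenic_d n c = {d. irreducible (gpoly n c d) \<and>
      (\<forall>\<theta>. poly (map_poly of_int (gpoly n c d)) \<theta> = 0 \<longrightarrow>
             Zadj \<theta> = ring_of_integers (Qadj \<theta>))}"

definition Bconst :: "nat \<Rightarrow> int \<Rightarrow> real" where
  "Bconst n c = 6 / pi^2 * (\<Prod>p\<in>prime_factors c. real_of_int p / (real_of_int p + 1))
     - (1 - 6 / pi^2 * (\<Prod>p\<in>prime_factors n. (real p)^2 / ((real p)^2 - 1)))"

end

theory Submission
  imports Defs "HOL-Analysis.Gamma_Function" "HOL-Number_Theory.Cong" "HOL-Real_Asymp.Real_Asymp"
    "Jordan_Normal_Form.Char_Poly"
begin

text \<open>
  The discriminant of \<open>g\<^sub>d\<close> is, up to sign, \<open>c^(n-1) d^(n-2) D\<close> with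
  \<open>D = n^n d + (-1)^(n-1) (n-1)^(n-1) c^(n-1)\<close>. If \<open>d\<close> is square-free and coprime to \<open>c\<close>, then
  \<open>g\<^sub>d\<close> is Eisenstein at every prime dividing \<open>c\<close>. Modulo any prime \<open>p\<close>, the factorisation
  \<open>g\<^sub>d' = x^(n-2) (n x + c (n-1))\<close> shows that the only repeated factor \<open>g\<^sub>d\<close> can have is linear, \<open>x - a\<close>
  with \<open>a = 0\<close> or \<open>n a = -c (n-1)\<close>; in the second case \<open>n^n g\<^sub>d(a) \<equiv> c D\<close> modulo \<open>p\<^sup>2\<close>. By Dedekind's
  criterion \<open>\<int>[\<theta>]\<close> is therefore maximal as soon as no \<open>p\<^sup>2\<close> with \<open>p\<close> prime to \<open>n c\<close> divides \<open>D\<close>.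

  The density of square-free \<open>d\<close> coprime to \<open>c\<close> is the first term of \<open>B\<close>, and the density of the \<open>d\<close> for
  which \<open>D\<close> is divisible by some \<open>p\<^sup>2\<close> with \<open>p\<close> prime to \<open>n c\<close> is at most the second one. Both are linear
  sieve problems: the Chinese remainder theorem handles the primes up to \<open>Y\<close>, and the larger ones contribute
  \<open>O(N/Y + \<surd>N)\<close>. Only the bound \<open>6/\<pi>\<^sup>2 \<le> \<Prod>(1 - 1/p\<^sup>2)\<close> for finite sets of primes is needed.
\<close>

section \<open>Algebraic integers form a ring\<close>

text \<open>The nonzero vector of the \<open>b i\<close> is an eigenvector of the integer matrix
  \<open>a\<close> for \<open>t\<close>, so \<open>t\<close> is a root of its characteristic
  polynomial, which is monic with integer coefficients.\<close>

lemma algebraic_int_eigenvalue: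
  fixes t :: complex and b :: "nat \<Rightarrow> complex" and a :: "nat \<Rightarrow> nat \<Rightarrow> int"
  assumes eig: "\<And>i. i < m \<Longrightarrow> t * b i = (\<Sum>j<m. of_int (a i j) * b j)"
    and nz: "k < m" "b k \<noteq> 0"
  shows "algebraic_int t"
proof -
  define A :: "int mat" where "A = mat m m (\<lambda>(i, j). a i j)"
  define v where "v = vec m b"
  have A: "A \<in> carrier_mat m m" by (simp add: A_def)
  let ?A = "map_mat complex_of_int A"
  have A': "?A \<in> carrier_mat m m" using A by simp
  have "v \<noteq> 0\<^sub>v m"
  proof
    assume "v = 0\<^sub>v m"
    then have "vec_index v k = 0" using nz by simp
    then show False using nz by (simp add: v_def)
  qed
  moreover have "?A *\<^sub>v v = t \<cdot>\<^sub>v v"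
  proof (rule eq_vecI)
    fix i assume "i < dim_vec (t \<cdot>\<^sub>v v)"
    then have i: "i < m" by (simp add: v_def)
    have "vec_index (?A *\<^sub>v v) i = (\<Sum>j<m. of_int (a i j) * b j)"
      using i by (simp add: A_def v_def scalar_prod_def atLeast0LessThan)
    then show "vec_index (?A *\<^sub>v v) i = vec_index (t \<cdot>\<^sub>v v) i"
      using i eig[OF i] by (simp add: v_def)
  qed (simp add: v_def A_def)
  ultimately have "eigenvector ?A v t"
    using A' by (simp add: eigenvector_def v_def A_def)
  then have "poly (char_poly ?A) t = 0"
    using eigenvalue_root_char_poly[OF A'] by (auto simp: eigenvalue_def)
  then have "poly (of_int_poly (char_poly A)) t = 0"
    by (simp add: of_int_hom.char_poly_hom[OF A])
  moreover have "monic (char_poly A)"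
    using degree_monic_char_poly[OF A] by simp
  ultimately show ?thesis
    unfolding algebraic_int_altdef_ipoly by blast
qed

definition int_span :: "('i \<Rightarrow> complex) \<Rightarrow> 'i set \<Rightarrow> complex set" where
  "int_span b I = {\<Sum>i\<in>I. of_int (f i) * b i | f. True}"

lemma int_span_base:
  assumes "finite I" "i \<in> I" shows "b i \<in> int_span b I"
proof -
  have "b i = (\<Sum>j\<in>I. of_int (if j = i then 1 else 0) * b j)"
    using assms by (simp add: if_distrib[of "\<lambda>x. of_int x * _"] cong: if_cong)
  then show ?thesis unfolding int_span_def mem_Collect_eq by (intro exI conjI TrueI)
qed

lemma int_span_0: "0 \<in> int_span b I"
  unfolding int_span_def by (auto intro!: exI[of _ "\<lambda>_. 0"])

lemma int_span_add:
  assumes "x \<in> int_span b I" "y \<in> int_span b I" shows "x + y \<in> int_span b I"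
proof -
  obtain f g where "x = (\<Sum>i\<in>I. of_int (f i) * b i)" "y = (\<Sum>i\<in>I. of_int (g i) * b i)"
    using assms by (auto simp: int_span_def)
  then have "x + y = (\<Sum>i\<in>I. of_int (f i + g i) * b i)"
    by (simp add: sum.distrib algebra_simps)
  then show ?thesis unfolding int_span_def mem_Collect_eq by (intro exI conjI TrueI)
qed

lemma int_span_scale:
  assumes "x \<in> int_span b I" shows "of_int k * x \<in> int_span b I"
proof -
  obtain f where "x = (\<Sum>i\<in>I. of_int (f i) * b i)"
    using assms by (auto simp: int_span_def)
  then have "of_int k * x = (\<Sum>i\<in>I. of_int (k * f i) * b i)"
    by (simp add: sum_distrib_left algebra_simps)
  then show ?thesis unfolding int_span_def mem_Collect_eq by (intro exI conjI TrueI)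
qed

lemma int_span_sum:
  "(\<And>j. j \<in> J \<Longrightarrow> f j \<in> int_span b I) \<Longrightarrow> sum f J \<in> int_span b I"
  by (induction J rule: infinite_finite_induct) (auto intro: int_span_0 int_span_add)

lemma int_span_mult:
  assumes "\<And>i. i \<in> I \<Longrightarrow> t * b i \<in> int_span b I" "x \<in> int_span b I"
  shows "t * x \<in> int_span b I"
proof -
  obtain f where "x = (\<Sum>i\<in>I. of_int (f i) * b i)"
    using assms by (auto simp: int_span_def)
  then have "t * x = (\<Sum>i\<in>I. of_int (f i) * (t * b i))"
    by (simp add: sum_distrib_left algebra_simps)
  then show ?thesis using assms by (auto intro!: int_span_sum int_span_scale)
qed

text \<open>Determinant trick without a basis: the coefficients of the \<open>t * b i\<close> give
  an integer matrix with eigenvector \<open>b\<close>. The index set is arbitrary so that pairs of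
  exponents can serve as indices.\<close>

lemma algebraic_int_if_stable_int_span:
  assumes "finite I" "\<And>i. i \<in> I \<Longrightarrow> t * b i \<in> int_span b I" "k \<in> I" "b k \<noteq> 0"
  shows "algebraic_int t"
proof -
  obtain e where e: "bij_betw e {..<card I} I"
    using ex_bij_betw_nat_finite[OF \<open>finite I\<close>] by (auto simp: atLeast0LessThan)
  have "\<exists>f. t * b i = (\<Sum>j\<in>I. of_int (f j) * b j)" if "i \<in> I" for i
    using assms(2)[OF that] by (auto simp: int_span_def)
  then obtain f where f: "\<And>i. i \<in> I \<Longrightarrow> t * b i = (\<Sum>j\<in>I. of_int (f i j) * b j)"
    by metis
  have eI: "e i \<in> I" if "i < card I" for i
    using e that by (auto simp: bij_betw_def)
  obtain k' where k': "k' < card I" "e k' = k"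
    using e \<open>k \<in> I\<close> unfolding bij_betw_def by (metis imageE lessThan_iff)
  show ?thesis
  proof (rule algebraic_int_eigenvalue[where b = "b \<circ> e" and a = "\<lambda>i j. f (e i) (e j)"])
    fix i assume "i < card I"
    then show "t * (b \<circ> e) i = (\<Sum>j<card I. of_int (f (e i) (e j)) * (b \<circ> e) j)"
      using f[OF eI] sum.reindex_bij_betw[OF e, of "\<lambda>j. of_int (f (e i) j) * b j"] by simp
  qed (use k' assms in auto)
qed

lemma algebraic_int_power_reduction:
  assumes "algebraic_int (x :: complex)"
  obtains k f where "k > 0" "x ^ k = (\<Sum>i<k. of_int (f i) * x ^ i)"
proof -
  obtain p where p: "poly (of_int_poly p) x = 0" "monic p"
    using assms unfolding algebraic_int_altdef_ipoly by blast
  have "degree p > 0"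
  proof (rule ccontr)
    assume "\<not> degree p > 0"
    then obtain a where "p = [:a:]" using degree_eq_zeroE by blast
    then show False using p by simp
  qed
  moreover have "poly (of_int_poly p) x = (\<Sum>i\<le>degree p. of_int (coeff p i) * x ^ i)"
    by (simp add: poly_altdef)
  then have "x ^ degree p = (\<Sum>i<degree p. of_int (- coeff p i) * x ^ i)"
    using p by (simp add: lessThan_Suc_atMost[symmetric] sum_negf eq_neg_iff_add_eq_0 add.commute)
  ultimately show ?thesis by (rule that)
qed

text \<open>The monomials \<open>x ^ i * y ^ j\<close> with \<open>i < k\<close> and
  \<open>j < l\<close> span a group stable under multiplication by \<open>x\<close> and by
  \<open>y\<close>, hence by their sum and product. Only a top exponent has to be rewritten.\<close>

lemma algebraic_int_add_mult:
  assumes "algebraic_int (x :: complex)" "algebraic_int y"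
  shows "algebraic_int (x + y)" and "algebraic_int (x * y)"
proof -
  obtain k f where k: "k > 0" and x: "x ^ k = (\<Sum>i<k. of_int (f i) * x ^ i)"
    by (rule algebraic_int_power_reduction[OF assms(1)])
  obtain l g where l: "l > 0" and y: "y ^ l = (\<Sum>i<l. of_int (g i) * y ^ i)"
    by (rule algebraic_int_power_reduction[OF assms(2)])
  define I where "I = {..<k} \<times> {..<l}"
  define b where "b = (\<lambda>(i, j). x ^ i * y ^ j)"
  have fin: "finite I" by (simp add: I_def)
  have xb: "x * b p \<in> int_span b I" if "p \<in> I" for p
  proof -
    obtain i j where p: "p = (i, j)" "i < k" "j < l" using \<open>p \<in> I\<close> by (auto simp: I_def)
    show ?thesis
    proof (cases "Suc i < k")
      case True
      then have "b (Suc i, j) \<in> int_span b I" using p fin by (intro int_span_base) (auto simp: I_def)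
      then show ?thesis using p by (simp add: b_def algebra_simps)
    next
      case False
      then have "Suc i = k" using p by simp
      then have "x * b p = x ^ k * y ^ j" using p by (auto simp: b_def)
      also have "\<dots> = (\<Sum>i<k. of_int (f i) * b (i, j))"
        by (simp add: x b_def sum_distrib_right mult.assoc)
      also have "\<dots> \<in> int_span b I"
        using p fin by (intro int_span_sum int_span_scale int_span_base) (auto simp: I_def)
      finally show ?thesis .
    qed
  qed
  have yb: "y * b p \<in> int_span b I" if "p \<in> I" for p
  proof -
    obtain i j where p: "p = (i, j)" "i < k" "j < l" using \<open>p \<in> I\<close> by (auto simp: I_def)
    show ?thesis
    proof (cases "Suc j < l")
      case True
      then have "b (i, Suc j) \<in> int_span b I" using p fin by (intro int_span_base) (auto simp: I_def)
      then show ?thesis using p by (simp add: b_def algebra_simps)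
    next
      case False
      then have "Suc j = l" using p by simp
      then have "y * b p = x ^ i * y ^ l" using p by (auto simp: b_def algebra_simps)
      also have "\<dots> = (\<Sum>j<l. of_int (g j) * b (i, j))"
        by (simp add: y b_def sum_distrib_left mult.left_commute)
      also have "\<dots> \<in> int_span b I"
        using p fin by (intro int_span_sum int_span_scale int_span_base) (auto simp: I_def)
      finally show ?thesis .
    qed
  qed
  \<comment> \<open>The monomial 1 serves as the nonzero generator; it is present because
    \<open>k\<close> and \<open>l\<close> are positive.\<close>
  have one: "(0, 0) \<in> I" "b (0, 0) \<noteq> 0" using k l by (auto simp: I_def b_def)
  show "algebraic_int (x + y)"
  proof (rule algebraic_int_if_stable_int_span[where b = b, OF fin _ one])
    show "(x + y) * b p \<in> int_span b I" if "p \<in> I" for p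
      using int_span_add[OF xb yb] that by (simp add: algebra_simps)
  qed
  show "algebraic_int (x * y)"
  proof (rule algebraic_int_if_stable_int_span[where b = b, OF fin _ one])
    show "x * y * b p \<in> int_span b I" if "p \<in> I" for p
      using int_span_mult[OF xb yb[OF that]] by (simp add: algebra_simps)
  qed
qed

lemma algebraic_int_diff:
  "algebraic_int (x :: complex) \<Longrightarrow> algebraic_int y \<Longrightarrow> algebraic_int (x - y)"
  using algebraic_int_add_mult(1)[of x "- y"] by auto

lemma algebraic_int_of_int_complex [simp]: "algebraic_int (of_int k :: complex)"
  by (rule int_imp_algebraic_int) simp

lemma algebraic_int_poly:
  assumes "algebraic_int (x :: complex)" shows "algebraic_int (poly (of_int_poly p) x)"
  using assms by (induction p) (auto intro!: algebraic_int_add_mult)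

section \<open>Ideals of integer polynomials containing a prime\<close>

lemma ipoly_simps:
  "poly (of_int_poly (f + g)) x = poly (of_int_poly f) x + poly (of_int_poly g) (x :: 'a :: comm_ring_1)"
  "poly (of_int_poly (f - g)) x = poly (of_int_poly f) x - poly (of_int_poly g) x"
  "poly (of_int_poly (f * g)) x = poly (of_int_poly f) x * poly (of_int_poly g) x"
  "poly (of_int_poly (Polynomial.smult k f)) x = of_int k * poly (of_int_poly f) x"
  "poly (of_int_poly (f ^ n)) x = poly (of_int_poly f) x ^ n"
  "poly (of_int_poly (pCons k f)) x = of_int k + x * poly (of_int_poly f) x"
  "poly (of_int_poly (sum h I)) x = (\<Sum>i\<in>I. poly (of_int_poly (h i)) x)"
  by (simp_all add: of_int_poly_hom.hom_add of_int_poly_hom.hom_minus of_int_poly_hom.hom_mult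
      of_int_poly_hom.hom_power of_int_poly_hom.hom_sum poly_sum of_int_hom.map_poly_hom_smult of_int_hom.map_poly_pCons_hom)

definition ring_ideal :: "'a :: comm_ring_1 set \<Rightarrow> bool" where
  "ring_ideal I \<longleftrightarrow> 0 \<in> I \<and> (\<forall>x\<in>I. \<forall>y\<in>I. x + y \<in> I) \<and> (\<forall>x\<in>I. \<forall>r. r * x \<in> I)"

lemma ring_idealD:
  assumes "ring_ideal I"
  shows "0 \<in> I" "x \<in> I \<Longrightarrow> y \<in> I \<Longrightarrow> x + y \<in> I" "x \<in> I \<Longrightarrow> r * x \<in> I" "x \<in> I \<Longrightarrow> x * r \<in> I"
    "x \<in> I \<Longrightarrow> y \<in> I \<Longrightarrow> x - y \<in> I"
proof -
  show "0 \<in> I" "x \<in> I \<Longrightarrow> y \<in> I \<Longrightarrow> x + y \<in> I" "x \<in> I \<Longrightarrow> r * x \<in> I" "x \<in> I \<Longrightarrow> x * r \<in> I"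
    using assms by (auto simp: ring_ideal_def mult.commute)
  show "x - y \<in> I" if "x \<in> I" "y \<in> I"
  proof -
    have "x + (- 1) * y \<in> I" using assms that unfolding ring_ideal_def by blast
    then show ?thesis by simp
  qed
qed

text \<open>Zorn's lemma gives an ideal \<open>P\<close> maximal among the proper ideals containing
  \<open>J\<close>. Maximal implies prime: if \<open>b\<close> is not in \<open>P\<close>, then
  \<open>1 = x + b * s\<close> with \<open>x\<close> in \<open>P\<close>, and multiplying by
  \<open>a\<close> puts \<open>a\<close> in \<open>P\<close>.\<close>

lemma proper_ideal_subset_prime_ideal:
  fixes J :: "'a :: comm_ring_1 set"
  assumes "ring_ideal J" "1 \<notin> J"
  obtains P where "ring_ideal P" "J \<subseteq> P" "1 \<notin> P" "\<And>a b. a * b \<in> P \<Longrightarrow> a \<in> P \<or> b \<in> P"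
proof -
  define \<A> where "\<A> = {I. ring_ideal I \<and> J \<subseteq> I \<and> 1 \<notin> I}"
  have "\<exists>M\<in>\<A>. \<forall>X\<in>\<A>. M \<subseteq> X \<longrightarrow> X = M"
  proof (rule subset_Zorn_nonempty)
    show "\<A> \<noteq> {}" using assms by (auto simp: \<A>_def)
    fix \<C> assume C: "\<C> \<noteq> {}" "subset.chain \<A> \<C>"
    have sub: "X \<in> \<A>" if "X \<in> \<C>" for X using C that by (auto simp: subset.chain_def)
    have lin: "X \<subseteq> Y \<or> Y \<subseteq> X" if "X \<in> \<C>" "Y \<in> \<C>" for X Y
      using C that unfolding subset.chain_def by blast
    have "ring_ideal (\<Union>\<C>)"
      unfolding ring_ideal_def
    proof (intro conjI ballI allI)
      show "0 \<in> \<Union>\<C>" using C sub by (auto simp: \<A>_def ring_ideal_def)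
      show "r * x \<in> \<Union>\<C>" if "x \<in> \<Union>\<C>" for x r
        using that sub by (fastforce simp: \<A>_def ring_ideal_def)
      fix x y assume "x \<in> \<Union>\<C>" "y \<in> \<Union>\<C>"
      then obtain X Y where XY: "X \<in> \<C>" "Y \<in> \<C>" "x \<in> X" "y \<in> Y" by blast
      then obtain Z where Z: "Z \<in> \<C>" "x \<in> Z" "y \<in> Z" using lin[of X Y] by blast
      then have "x + y \<in> Z" using sub[of Z] by (auto simp: \<A>_def ring_ideal_def)
      then show "x + y \<in> \<Union>\<C>" using Z by blast
    qed
    then show "\<Union>\<C> \<in> \<A>" using C sub by (auto simp: \<A>_def)
  qed
  then obtain P where P: "P \<in> \<A>" and max: "\<And>X. X \<in> \<A> \<Longrightarrow> P \<subseteq> X \<Longrightarrow> X = P" by blast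
  have id: "ring_ideal P" using P by (auto simp: \<A>_def)
  show ?thesis
  proof (rule that)
    show "ring_ideal P" "J \<subseteq> P" "1 \<notin> P" using P by (auto simp: \<A>_def)
    fix a b assume ab: "a * b \<in> P"
    show "a \<in> P \<or> b \<in> P"
    proof (rule disjCI)
      assume b: "b \<notin> P"
      define X where "X = {x + b * s | x s. x \<in> P}"
      have "ring_ideal X" unfolding ring_ideal_def
      proof (intro conjI ballI allI)
        show "0 \<in> X" using ring_idealD(1)[OF id] by (auto simp: X_def intro!: exI[of _ 0])
        fix u assume "u \<in> X"
        then obtain x s where u: "u = x + b * s" "x \<in> P" by (auto simp: X_def)
        { fix r show "r * u \<in> X"
            using u ring_idealD(3)[OF id, of x r] unfolding X_def mem_Collect_eq
            by (intro exI[of _ "r * x"] exI[of _ "r * s"]) (simp add: algebra_simps) }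
        fix v assume "v \<in> X"
        then obtain y t where v: "v = y + b * t" "y \<in> P" by (auto simp: X_def)
        then show "u + v \<in> X"
          using u ring_idealD(2)[OF id, of x y] unfolding X_def mem_Collect_eq
          by (intro exI[of _ "x + y"] exI[of _ "s + t"]) (simp add: algebra_simps)
      qed
      moreover have PX: "P \<subseteq> X"
      proof (rule subsetI)
        fix x assume x: "x \<in> P"
        show "x \<in> X" unfolding X_def mem_Collect_eq by (intro exI[of _ x] exI[of _ 0]) (simp add: x)
      qed
      moreover have "b \<in> X" unfolding X_def mem_Collect_eq
        using ring_idealD(1)[OF id] by (intro exI[of _ 0] exI[of _ 1]) simp
      ultimately have "1 \<in> X" using max[of X] b P by (auto simp: \<A>_def)
      then obtain x s where xs: "1 = x + b * s" "x \<in> P" by (auto simp: X_def)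
      have "a = a * (x + b * s)" by (simp flip: xs(1))
      also have "\<dots> = a * x + s * (a * b)" by (simp add: algebra_simps)
      also have "\<dots> \<in> P" using ring_idealD[OF id] xs ab by blast
      finally show "a \<in> P" .
    qed
  qed
qed

text \<open>Pseudo-division scales \<open>f\<close> by a power of the leading coefficient of
  \<open>w\<close>, which is 1 here.\<close>

lemma monic_division:
  fixes f w :: "int poly"
  assumes "monic w"
  obtains q r where "f = w * q + r" "r = 0 \<or> degree r < degree w"
proof -
  have "w \<noteq> 0" using assms by auto
  moreover obtain q r where "pseudo_divmod f w = (q, r)" by fastforce
  ultimately have "f = w * q + r" "r = 0 \<or> degree r < degree w"
    using pseudo_divmod[of w f q r] assms by auto
  then show ?thesis by (rule that)
qed

lemma bezout_prime_int:
  fixes p k :: int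
  assumes "prime p" "\<not> p dvd k"
  obtains a b where "a * k + b * p = 1"
proof -
  have "coprime k p" using assms prime_imp_coprime[of p k] by (simp add: coprime_commute)
  then show ?thesis using that bezout_int[of k p] by (auto simp: coprime_iff_gcd_eq_1)
qed

text \<open>A leading coefficient prime to \<open>p\<close> could be made 1 by Bezout, using
  \<open>[:p:]\<close> in \<open>I\<close>, giving a monic element of degree below that of
  \<open>w\<close>. So \<open>p\<close> divides it, the leading term can be subtracted without
  leaving \<open>I\<close>, and induction on the degree applies.\<close>

lemma prime_dvd_if_degree_below_minimal_monic:
  fixes p :: int and I :: "int poly set"
  assumes p: "prime p" and I: "ring_ideal I" "[:p:] \<in> I"
    and w: "w \<in> I" "monic w" and min: "\<And>f. f \<in> I \<Longrightarrow> monic f \<Longrightarrow> degree w \<le> degree f"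
    and f: "f \<in> I" "f = 0 \<or> degree f < degree w"
  shows "[:p:] dvd f"
  using f
proof (induction "degree f" arbitrary: f rule: less_induct)
  case less
  show ?case
  proof (cases "f = 0")
    case False
    have "p dvd lead_coeff f"
    proof (rule ccontr)
      assume "\<not> p dvd lead_coeff f"
      then obtain a b where ab: "a * lead_coeff f + b * p = 1" using bezout_prime_int[OF p] by blast
      define h where "h = [:a:] * f + monom b (degree f) * [:p:]"
      have "h \<in> I" unfolding h_def by (intro ring_idealD(2,3,5)[OF I(1)] less.prems I(2))
      moreover have c: "coeff h i = a * coeff f i + (if i = degree f then b * p else 0)" for i
        by (simp add: h_def mult.commute)
      have "degree h \<le> degree f" by (rule degree_le) (auto simp: c coeff_eq_0)
      moreover have "coeff h (degree f) = 1" using ab by (simp add: c)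
      ultimately have "monic h" "degree h = degree f"
        using le_degree[of h "degree f"] by auto
      then show False using min[OF \<open>h \<in> I\<close>] less.prems False by simp
    qed
    then obtain k where k: "lead_coeff f = p * k" by (auto elim: dvdE)
    define h where "h = f - monom k (degree f) * [:p:]"
    have hI: "h \<in> I" unfolding h_def by (intro ring_idealD(2,3,5)[OF I(1)] less.prems I(2))
    have c: "coeff h i = (if i = degree f then 0 else coeff f i)" for i
      using k by (auto simp: h_def mult.commute)
    have "h = 0 \<or> degree h < degree f"
    proof (rule disjCI)
      assume "\<not> degree h < degree f"
      moreover have "degree h \<le> degree f" by (rule degree_le) (auto simp: c coeff_eq_0)
      ultimately have "lead_coeff h = 0" by (simp add: c)
      then show "h = 0" by simp
    qed
    then have "[:p:] dvd h" using less.hyps[of h] hI less.prems False by auto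
    moreover have "f = h + monom k (degree f) * [:p:]" by (simp add: h_def)
    ultimately show ?thesis by (metis dvd_add dvd_triv_right)
  qed auto
qed

text \<open>Modulo \<open>p\<close> the ideal \<open>I\<close> is generated by \<open>w\<close>, as
  polynomials over the field with \<open>p\<close> elements form a principal ideal domain. The
  degree bound on \<open>r\<close> later shows that the cofactor of \<open>w\<close> in
  \<open>g\<close> is monic.\<close>

lemma ideal_mod_prime_generated_by_minimal_monic:
  fixes p :: int and I :: "int poly set"
  assumes p: "prime p" and I: "ring_ideal I" "[:p:] \<in> I"
    and w: "w \<in> I" "monic w" and min: "\<And>f. f \<in> I \<Longrightarrow> monic f \<Longrightarrow> degree w \<le> degree f"
    and f: "f \<in> I"
  obtains q r where "f = w * q + [:p:] * r" "degree r < degree w \<or> r = 0"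
proof -
  obtain q r where qr: "f = w * q + r" "r = 0 \<or> degree r < degree w"
    by (rule monic_division[OF w(2)])
  have "f - w * q \<in> I" by (intro ring_idealD(4,5)[OF I(1)] f w)
  then have "r \<in> I" using qr by simp
  then obtain s where s: "r = [:p:] * s"
    using prime_dvd_if_degree_below_minimal_monic[OF p I w min] qr by (metis dvdE)
  moreover have "degree r = degree s" using s p by auto
  ultimately show ?thesis using qr that[of q s] p by auto
qed

text \<open>At a complex root of \<open>v\<close> such an identity would make \<open>1 / p\<close>
  the value of \<open>b\<close>, a rational algebraic integer that is not an integer.\<close>

lemma one_notin_ideal_mod_prime:
  fixes p :: int and v :: "int poly"
  assumes "prime p" "monic v" "degree v > 0"
  shows "1 \<noteq> v * a + [:p:] * b"
proof
  assume eq: "1 = v * a + [:p:] * b"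
  have "\<not> constant (poly (of_int_poly v :: complex poly))"
    using assms by (simp add: constant_degree)
  then obtain z :: complex where z: "poly (of_int_poly v) z = 0"
    using fundamental_theorem_of_algebra by blast
  then have "algebraic_int z" using assms unfolding algebraic_int_altdef_ipoly by blast
  then have int: "algebraic_int (poly (of_int_poly b) z)" by (rule algebraic_int_poly)
  have "poly (of_int_poly (v * a + [:p:] * b)) z = (1 :: complex)" unfolding eq[symmetric] by simp
  then have e: "of_int p * poly (of_int_poly b) z = (1 :: complex)"
    using z by (simp add: ipoly_simps)
  have "p \<noteq> 0" using assms by auto
  then have "poly (of_int_poly b) z = (1 / of_int p :: complex)" using e by (simp add: field_simps)
  then have "poly (of_int_poly b) z \<in> (\<rat> :: complex set)" by simp
  then have "poly (of_int_poly b) z \<in> (\<int> :: complex set)"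
    using int rational_algebraic_int_is_int by blast
  then obtain k where "poly (of_int_poly b) z = (of_int k :: complex)" by (auto elim: Ints_cases)
  then have "of_int (p * k) = (1 :: complex)" using e by simp
  then have "p * k = 1" by (simp only: of_int_eq_1_iff)
  then show False using assms by (metis dvd_triv_left not_prime_unit)
qed

lemma prime_ideal_int_const:
  assumes "ring_ideal P" "1 \<notin> P" "prime p" "[:p:] \<in> P" "[:k:] \<in> P"
  shows "(p :: int) dvd k"
proof (rule ccontr)
  assume "\<not> p dvd k"
  then obtain a b where ab: "a * k + b * p = 1" using bezout_prime_int[OF \<open>prime p\<close>] by blast
  have "[:a:] * [:k:] + [:b:] * [:p:] \<in> P" by (intro ring_idealD(2,3)[OF assms(1)] assms)
  also have "[:a:] * [:k:] + [:b:] * [:p:] = [:a * k + b * p:]" by simp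
  also have "\<dots> = 1" by (simp add: ab)
  finally show False using assms by simp
qed

text \<open>Modulo \<open>[:- a, 1:]\<close> the polynomial \<open>f\<close> is the constant
  \<open>poly f a\<close>, and the only integers in \<open>P\<close> are the multiples of
  \<open>p\<close>.\<close>

lemma prime_ideal_poly_dvd:
  assumes "ring_ideal P" "1 \<notin> P" "prime p" "[:p:] \<in> P" "[:- a, 1:] \<in> P" "f \<in> P"
  shows "(p :: int) dvd poly f a"
proof (rule prime_ideal_int_const[OF assms(1-4)])
  have "f - [:- a, 1:] * synthetic_div f a \<in> P"
    by (intro ring_idealD(4,5)[OF assms(1)] assms)
  also have "f - [:- a, 1:] * synthetic_div f a = [:poly f a:]"
    using synthetic_div_correct'[of a f] by (simp add: algebra_simps)
  finally show "[:poly f a:] \<in> P" .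
qed

section \<open>Monogenicity criterion\<close>

text \<open>A form of Gauss's lemma. A nonzero polynomial \<open>h\<close> of least degree vanishing
  at \<open>\<theta>\<close> divides every other one up to a nonzero integer factor. Since
  \<open>g\<close> is a prime element dividing no nonzero constant, it suffices that
  \<open>g\<close> divides \<open>h\<close>.\<close>

lemma irreducible_dvd_if_common_root:
  fixes g f :: "int poly" and \<theta> :: complex
  assumes g: "irreducible g" "degree g > 0" and root: "poly (of_int_poly g) \<theta> = 0"
    and f: "poly (of_int_poly f) \<theta> = 0"
  shows "g dvd f"
proof -
  define R where "R f \<longleftrightarrow> f \<noteq> 0 \<and> poly (of_int_poly f) \<theta> = 0" for f :: "int poly"
  have "R g" using g root by (auto simp: R_def)
  then obtain h where h: "R h" and min: "\<And>f. R f \<Longrightarrow> degree h \<le> degree f"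
    using ex_has_least_nat[of R g degree] by blast
  have prime: "prime_elem g" using g by (intro irreducible_imp_prime_elem)
  have h_dvd: "\<exists>k. k \<noteq> 0 \<and> h dvd [:k:] * f" if "poly (of_int_poly f) \<theta> = 0" for f
  proof -
    define k where "k = lead_coeff h ^ (Suc (degree f) - degree h)"
    obtain q r where "pseudo_divmod f h = (q, r)" by fastforce
    then have qr: "[:k:] * f = h * q + r" "r = 0 \<or> degree r < degree h"
      using pseudo_divmod[of h f q r] h by (auto simp: R_def k_def)
    have "poly (of_int_poly ([:k:] * f)) \<theta> = poly (of_int_poly (h * q + r)) \<theta>"
      by (simp only: qr)
    then have "poly (of_int_poly r) \<theta> = 0"
      using that h by (simp add: R_def ipoly_simps)
    then have "r = 0" using min[of r] qr(2) unfolding R_def by linarith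
    moreover have "k \<noteq> 0" using h by (auto simp: k_def R_def)
    ultimately show ?thesis using qr by auto
  qed
  have nconst: "\<not> g dvd [:k:]" if "k \<noteq> 0" for k
    using that g dvd_imp_degree_le[of g "[:k:]"] by auto
  have "g dvd h"
  proof -
    obtain k q where kq: "k \<noteq> 0" "[:k:] * g = h * q" using h_dvd[OF root] by (metis dvdE)
    have "g dvd h * q" by (metis kq(2) dvd_triv_right)
    then have "g dvd h \<or> g dvd q" using prime by (simp add: prime_elem_dvd_mult_iff)
    then show ?thesis
    proof
      \<comment> \<open>Cancelling \<open>g\<close> would make \<open>h\<close> a divisor of a
        nonzero constant, which does not vanish at \<open>\<theta>\<close>.\<close>
      assume "g dvd q"
      then obtain q' where "q = g * q'" by (auto elim: dvdE)
      then have "[:k:] * g = (h * q') * g" using kq by (simp add: algebra_simps)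
      then have k: "[:k:] = h * q'" using g by (metis irreducible_def mult_cancel_right)
      have "poly (of_int_poly [:k:]) \<theta> = poly (of_int_poly (h * q')) \<theta>" by (simp only: k)
      then have "k = 0" using h by (simp add: R_def ipoly_simps)
      then show ?thesis using kq by simp
    qed
  qed
  moreover obtain k where "k \<noteq> 0" "h dvd [:k:] * f" using h_dvd[OF f] by blast
  ultimately have "g dvd [:k:] * f" "\<not> g dvd [:k:]" using nconst by (auto intro: dvd_trans)
  then show ?thesis using prime prime_elem_dvd_mult_iff by blast
qed

text \<open>Multiplying a monic equation for the quotient by \<open>p ^ k\<close> shows that
  \<open>w ^ k - [:p:] * r\<close> vanishes at \<open>\<theta>\<close>, so \<open>g\<close> divides
  it. Consequently \<open>w\<close> lies in every prime ideal containing \<open>p\<close> and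
  \<open>g\<close>.\<close>

lemma power_mod_prime_if_integral_quotient:
  fixes g w :: "int poly" and \<theta> :: complex and p :: int
  assumes g: "irreducible g" "degree g > 0" and root: "poly (of_int_poly g) \<theta> = 0"
    and p: "p \<noteq> 0" and int: "algebraic_int (poly (of_int_poly w) \<theta> / of_int p)"
  obtains k q r where "w ^ k = g * q + [:p:] * r"
proof -
  define y where "y = poly (of_int_poly w) \<theta> / of_int p"
  obtain k f where k: "y ^ k = (\<Sum>i<k. of_int (f i) * y ^ i)"
    using algebraic_int_power_reduction[OF int] unfolding y_def by metis
  \<comment> \<open>Of the \<open>k\<close> factors \<open>p\<close>, one stays outside
    \<open>r\<close> and \<open>i\<close> go with \<open>y ^ i\<close>, which leaves the exponent
    \<open>k - 1 - i\<close>.\<close>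
  define r where "r = (\<Sum>i<k. [:f i * p ^ (k - 1 - i):] * w ^ i)"
  have wy: "poly (of_int_poly w) \<theta> = of_int p * y" using p by (simp add: y_def)
  have "poly (of_int_poly (w ^ k - [:p:] * r)) \<theta> = 
     (of_int p * y) ^ k - of_int p * (\<Sum>i<k. of_int (f i * p ^ (k - 1 - i)) * (of_int p * y) ^ i)"
    by (simp add: r_def ipoly_simps wy)
  also have "of_int p * (\<Sum>i<k. of_int (f i * p ^ (k - 1 - i)) * (of_int p * y) ^ i)
     = of_int p ^ k * (\<Sum>i<k. of_int (f i) * y ^ i)"
    unfolding sum_distrib_left
  proof (rule sum.cong)
    fix i assume "i \<in> {..<k}"
    then have "k = Suc (k - 1 - i) + i" by auto
    then have "of_int p ^ k = (of_int p :: complex) * of_int p ^ (k - 1 - i) * of_int p ^ i"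
      by (metis power_add power_Suc)
    then show "of_int p * (of_int (f i * p ^ (k - 1 - i)) * (of_int p * y) ^ i)
      = of_int p ^ k * (of_int (f i) * y ^ i)"
      by (simp add: power_mult_distrib)
  qed simp
  also have "(of_int p * y) ^ k - of_int p ^ k * (\<Sum>i<k. of_int (f i) * y ^ i) = 0"
    by (simp add: power_mult_distrib k)
  finally have "g dvd w ^ k - [:p:] * r"
    by (rule irreducible_dvd_if_common_root[OF g root])
  then obtain q where "w ^ k - [:p:] * r = g * q" by (auto elim: dvdE)
  then have "w ^ k = g * q + [:p:] * r" by (simp add: algebra_simps)
  then show ?thesis by (rule that)
qed

lemma ring_ideal_integral_quotients:
  assumes "algebraic_int (\<theta> :: complex)"
  shows "ring_ideal {f. algebraic_int (poly (of_int_poly f) \<theta> / of_int p)}"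
  unfolding ring_ideal_def
proof (intro conjI ballI allI)
  fix x y assume "x \<in> {f. algebraic_int (poly (of_int_poly f) \<theta> / of_int p)}"
    "y \<in> {f. algebraic_int (poly (of_int_poly f) \<theta> / of_int p)}"
  then show "x + y \<in> {f. algebraic_int (poly (of_int_poly f) \<theta> / of_int p)}"
    using algebraic_int_add_mult(1) by (simp add: of_int_poly_hom.hom_add add_divide_distrib)
next
  fix x r assume "x \<in> {f. algebraic_int (poly (of_int_poly f) \<theta> / of_int p)}"
  then show "r * x \<in> {f. algebraic_int (poly (of_int_poly f) \<theta> / of_int p)}"
    using algebraic_int_add_mult(2)[OF algebraic_int_poly[OF assms, of r]]
    by (simp add: of_int_poly_hom.hom_mult mult.assoc flip: times_divide_eq_right)
qed auto

text \<open>
  The hypothesis \<open>double\<close> says that every double root of \<open>g\<close> modulo \<open>p\<close> is the class of an integer \<open>a\<close>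
  with \<open>p\<^sup>2 \<nmid> g(a)\<close>; prime ideals containing \<open>p\<close> stand for roots in an algebraic closure of the field
  with \<open>p\<close> elements. The ideal \<open>I\<close> of all \<open>f\<close> with \<open>f(\<theta>)/p\<close> integral is generated by \<open>p\<close> and a monic \<open>w\<close>
  dividing \<open>g\<close> modulo \<open>p\<close>. If \<open>w \<noteq> g\<close>, then \<open>w\<close> and \<open>g/w\<close> share a factor \<open>x - a\<close> modulo \<open>p\<close>, and
  \<open>p\<^sup>2 \<nmid> g(a)\<close> makes \<open>\<theta> - a\<close> and \<open>p\<close> coprime among the integral elements, so that \<open>w/(x - a)\<close> lies in \<open>I\<close>
  as well.
\<close>
lemma dedekind_criterion:
  fixes g h :: "int poly" and \<theta> :: complex and p :: int
  assumes g: "irreducible g" "degree g > 0" "monic g" and root: "poly (of_int_poly g) \<theta> = 0"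
    and p: "prime p"
    and double: "\<And>P. ring_ideal P \<Longrightarrow> 1 \<notin> P \<Longrightarrow> (\<And>a b. a * b \<in> P \<Longrightarrow> a \<in> P \<or> b \<in> P) \<Longrightarrow>
      [:p:] \<in> P \<Longrightarrow> g \<in> P \<Longrightarrow> pderiv g \<in> P \<Longrightarrow> \<exists>a. [:- a, 1:] \<in> P \<and> \<not> p\<^sup>2 dvd poly g a"
    and int: "algebraic_int (poly (of_int_poly h) \<theta> / of_int p)"
  obtains h' where "poly (of_int_poly h) \<theta> = of_int p * poly (of_int_poly h') \<theta>"
proof -
  let ?e = "\<lambda>f :: int poly. poly (of_int_poly f) \<theta>"
  have e_simps: "?e (f1 * f2) = ?e f1 * ?e f2" "?e (f1 + f2) = ?e f1 + ?e f2" 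
     "?e (f1 - f2) = ?e f1 - ?e f2" for f1 f2
    by (simp_all add: of_int_poly_hom.hom_mult of_int_poly_hom.hom_add of_int_poly_hom.hom_minus)
  have p0: "p \<noteq> 0" using p by auto
  have \<theta>: "algebraic_int \<theta>" using g root unfolding algebraic_int_altdef_ipoly by blast
  define I where "I = {f. algebraic_int (?e f / of_int p)}"
  have I: "ring_ideal I" unfolding I_def by (rule ring_ideal_integral_quotients[OF \<theta>])
  have pI: "[:p:] \<in> I" using p0 by (simp add: I_def)
  have gI: "g \<in> I" using root by (simp add: I_def)
  obtain w where w: "w \<in> I" "monic w" and min: "\<And>f. f \<in> I \<Longrightarrow> monic f \<Longrightarrow> degree w \<le> degree f"
    using ex_has_least_nat[of "\<lambda>f. f \<in> I \<and> monic f" g degree] gI g by blast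
  have gen: "\<exists>q r. f = w * q + [:p:] * r \<and> (degree r < degree w \<or> r = 0)" if "f \<in> I" for f
    by (rule ideal_mod_prime_generated_by_minimal_monic[OF p I pI w min that]) blast+
  obtain v s where g_eq: "g = w * v + [:p:] * s" and deg_s: "degree s < degree w \<or> s = 0"
    using gen[OF gI] by blast
  \<comment> \<open>As \<open>s\<close> has smaller degree than \<open>w\<close>, the term
    \<open>[:p:] * s\<close> cannot reach the leading coefficient of \<open>w * v\<close>.\<close>
  have v: "monic v"
  proof (cases "v = 0")
    case True
    then have "g = [:p:] * s" using g_eq by simp
    then have "lead_coeff g = p * lead_coeff s" by simp
    then have "p dvd 1" using g by (metis dvd_triv_left)
    then show ?thesis using p not_prime_unit by blast
  next
    case False
    have "w \<noteq> 0" using w by auto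
    then have "degree w \<le> degree (w * v)" using False by (simp add: degree_mult_eq)
    then have "degree ([:p:] * s) < degree (w * v) \<or> [:p:] * s = 0" using deg_s p0 by auto
    then have "lead_coeff g = lead_coeff (w * v)"
      unfolding g_eq using lead_coeff_add_le[of "[:p:] * s" "w * v"] by (metis add.commute add_0)
    then show ?thesis using g w by (simp add: lead_coeff_mult)
  qed
  show ?thesis
  proof (cases "degree v = 0")
    \<comment> \<open>Here \<open>w\<close> takes the value \<open>- p * s(\<theta>)\<close> at
      \<open>\<theta>\<close>; so every element of \<open>I\<close>, being generated by
      \<open>w\<close> and \<open>p\<close>, takes a value that is \<open>p\<close> times a
      polynomial in \<open>\<theta>\<close>.\<close>
    case True
    then have "v = 1" using v by (metis monic_degree_0)
    then have "?e w = - of_int p * ?e s"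
      using root g_eq by (simp add: ipoly_simps add_eq_0_iff)
    moreover obtain q r where "h = w * q + [:p:] * r" using gen[of h] int by (auto simp: I_def)
    ultimately have "?e h = of_int p * ?e (r - s * q)"
      by (simp add: ipoly_simps algebra_simps)
    then show ?thesis by (rule that)
  next
    case False
    \<comment> \<open>The ideal generated by \<open>v\<close> and \<open>p\<close> is proper because
      \<open>v\<close> is not constant, so a prime ideal \<open>P\<close> contains it.
      \<open>P\<close> also contains \<open>w\<close>, which is nilpotent modulo \<open>g\<close>
      and \<open>p\<close>.\<close>
    define J where "J = {v * a + [:p:] * b | a b. True}"
    have "ring_ideal J" unfolding ring_ideal_def
    proof (intro conjI ballI allI)
      show "0 \<in> J" by (auto simp: J_def intro!: exI[of _ 0])
      fix x assume "x \<in> J"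
      then obtain a b where x: "x = v * a + [:p:] * b" by (auto simp: J_def)
      { fix r
        have "r * x = v * (r * a) + [:p:] * (r * b)" by (simp add: x algebra_simps)
        then show "r * x \<in> J" unfolding J_def by blast }
      fix y assume "y \<in> J"
      then obtain a' b' where "y = v * a' + [:p:] * b'" by (auto simp: J_def)
      then have "x + y = v * (a + a') + [:p:] * (b + b')" by (simp add: x smult_add_right algebra_simps)
      then show "x + y \<in> J" unfolding J_def by blast
    qed
    moreover have "1 \<notin> J"
      using one_notin_ideal_mod_prime[OF p v] False unfolding J_def by blast
    ultimately obtain P where P: "ring_ideal P" "J \<subseteq> P" "1 \<notin> P"
      and prime: "\<And>a b. a * b \<in> P \<Longrightarrow> a \<in> P \<or> b \<in> P"
      using proper_ideal_subset_prime_ideal by blast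
    note PD = ring_idealD[OF P(1)]
    have "v * 1 + [:p:] * 0 \<in> J" "v * 0 + [:p:] * 1 \<in> J" unfolding J_def by blast+
    then have vP: "v \<in> P" and pP: "[:p:] \<in> P" using P by auto
    have gP: "g \<in> P" unfolding g_eq by (intro PD(2) PD(3)[OF vP] PD(4)[OF pP])
    obtain k q r where "w ^ k = g * q + [:p:] * r"
      using power_mod_prime_if_integral_quotient[OF g(1,2) root p0] w(1)
      unfolding I_def mem_Collect_eq by blast
    then have "w ^ k \<in> P" using PD gP pP by metis
    then have wP: "w \<in> P"
    proof (induction k)
      case (Suc k)
      then show ?case using prime by auto
    qed (use P in simp)
    \<comment> \<open>Each summand contains \<open>v\<close>, \<open>w\<close> or \<open>p\<close>,
      so the derivative lies in \<open>P\<close> and \<open>double\<close> applies.\<close>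
    have "pderiv g = w * pderiv v + v * pderiv w + [:p:] * pderiv s"
      unfolding g_eq by (simp add: pderiv_add pderiv_mult pderiv_smult)
    then have "pderiv g \<in> P" using PD wP vP pP by metis
    then obtain a where a: "[:- a, 1:] \<in> P" "\<not> p\<^sup>2 dvd poly g a"
      using double[OF P(1,3) prime pP gP] by blast
    note dvd = prime_ideal_poly_dvd[OF P(1,3) p pP a(1)]
    define X where "X = [:- a, 1:]"
    define w1 where "w1 = synthetic_div w a"
    define v1 where "v1 = synthetic_div v a"
    have w_eq: "w = X * w1 + [:poly w a:]" and v_eq: "v = X * v1 + [:poly v a:]"
      using synthetic_div_correct'[of a] by (simp_all add: X_def w1_def v1_def)
    obtain v0 where v0: "poly v a = p * v0" using dvd[OF vP] by (auto elim: dvdE)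
    obtain w0 where w0: "poly w a = p * w0" using dvd[OF wP] by (auto elim: dvdE)
    \<comment> \<open>With \<open>X = x - a\<close> the factorisation becomes
      \<open>g = X * u + p * t\<close>; then \<open>p^2\<close> not dividing \<open>g(a)\<close>
      means that \<open>p\<close> does not divide \<open>t(a)\<close>.\<close>
    define t where "t = [:v0:] * w + s"
    define u where "u = w * v1"
    have "[:p * v0:] = [:p:] * [:v0:]" by simp
    then have g_eq': "g = X * u + [:p:] * t"
      unfolding g_eq by (subst v_eq) (simp only: v0 t_def u_def algebra_simps)
    have "poly g a = p * poly t a" by (simp add: g_eq' X_def)
    then have "\<not> p dvd poly t a" using a(2) by (auto simp: power2_eq_square)
    then obtain \<alpha> \<beta> where \<alpha>: "\<alpha> * poly t a + \<beta> * p = 1" using bezout_prime_int[OF p] by blast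
    define t1 where "t1 = synthetic_div t a"
    have t_eq: "t = X * t1 + [:poly t a:]"
      using synthetic_div_correct'[of a] by (simp_all add: X_def t1_def)
    have "u \<in> I" unfolding u_def by (intro ring_idealD(4)[OF I] w)
    \<comment> \<open>From \<open>g(\<theta>) = 0\<close> and \<open>t = X * t1 + t(a)\<close>
      follows \<open>X(\<theta>) * z = - t(a)\<close>: the integer \<open>t(a)\<close>, prime to
      \<open>p\<close>, is a multiple of \<open>X(\<theta>)\<close> among the integral
      elements.\<close>
    define z where "z = ?e u / of_int p + ?e t1"
    have z: "algebraic_int z" unfolding z_def
      using \<open>u \<in> I\<close> \<theta> by (intro algebraic_int_add_mult algebraic_int_poly) (auto simp: I_def)
    have gt: "?e X * ?e u + of_int p * ?e t = 0" using root by (simp add: g_eq' ipoly_simps)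
    have et: "?e t = ?e X * ?e t1 + of_int (poly t a)" by (subst t_eq) (simp add: ipoly_simps)
    have "of_int p * z = ?e u + of_int p * ?e t1" using p0 by (simp add: z_def distrib_left)
    then have "of_int p * (?e X * z) = ?e X * (?e u + of_int p * ?e t1)"
      by (metis mult.left_commute)
    also have "\<dots> = (?e X * ?e u + of_int p * ?e t) + of_int p * (- of_int (poly t a))"
      unfolding et by (simp add: algebra_simps)
    finally have "of_int p * (?e X * z) = of_int p * (- of_int (poly t a))" by (simp only: gt add_0)
    then have Xz: "?e X * z = - of_int (poly t a)" using p0 by (metis mult_left_cancel of_int_eq_0_iff)
    have "?e w = ?e X * ?e w1 + of_int p * of_int w0"
      by (subst w_eq) (simp add: ipoly_simps w0)
    then have "?e X * ?e w1 / of_int p = ?e w / of_int p - of_int w0"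
      using p0 by (metis add_diff_cancel_right' add_divide_distrib nonzero_mult_div_cancel_left of_int_eq_0_iff)
    moreover have "algebraic_int (?e w / of_int p - of_int w0)"
      using w by (intro algebraic_int_diff) (auto simp: I_def)
    ultimately have Xw1: "algebraic_int (?e X * ?e w1 / of_int p)" by simp
    have aux: "(A * - (B * z) + C * D) * (E / D) = C * E - A * z * (B * E / D)"
      if "D \<noteq> 0" for A B C D E :: complex
      using that by (simp add: field_simps)
    have "of_int (\<alpha> * poly t a + \<beta> * p) = (1 :: complex)" by (simp only: \<alpha> of_int_1)
    then have one: "of_int \<alpha> * of_int (poly t a) + of_int \<beta> * of_int p = (1 :: complex)" by simp
    \<comment> \<open>Inserting \<open>\<alpha> * t(a) + \<beta> * p = 1\<close> writes
      \<open>w1(\<theta>) / p\<close> as a combination of \<open>w1(\<theta>)\<close>,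
      \<open>z\<close> and \<open>X(\<theta>) * w1(\<theta>) / p\<close>, all integral.\<close>
    have "?e w1 / of_int p = (of_int \<alpha> * of_int (poly t a) + of_int \<beta> * of_int p) * (?e w1 / of_int p)"
      by (simp only: one mult_1)
    also have "of_int (poly t a) = - (?e X * z)" using Xz by simp
    also have "(of_int \<alpha> * - (?e X * z) + of_int \<beta> * of_int p) * (?e w1 / of_int p)
      = of_int \<beta> * ?e w1 - of_int \<alpha> * z * (?e X * ?e w1 / of_int p)"
      using aux p0 by simp
    finally have "w1 \<in> I" unfolding I_def mem_Collect_eq
      by (simp only:) (intro algebraic_int_diff algebraic_int_add_mult(2) algebraic_int_poly
          algebraic_int_of_int_complex Xw1 z \<theta>)
    \<comment> \<open>A positive degree makes the quotient \<open>w1\<close> monic of strictly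
      smaller degree, which contradicts the choice of \<open>w\<close>.\<close>
    have "degree w > 0"
    proof (rule ccontr)
      assume "\<not> degree w > 0"
      then have "w = 1" using w by (metis monic_degree_0 neq0_conv)
      then show False using wP P by simp
    qed
    then have "degree w1 < degree w" by (simp add: w1_def degree_synthetic_div)
    moreover have "monic w1"
    proof -
      have "coeff w (Suc (degree w1)) = lead_coeff w1"
        by (subst w_eq) (simp add: X_def coeff_eq_0)
      then show ?thesis using w \<open>degree w > 0\<close> by (simp add: w1_def degree_synthetic_div)
    qed
    ultimately show ?thesis using min[OF \<open>w1 \<in> I\<close>] by simp
  qed
qed

section \<open>From maximality at each prime to the full ring of integers\<close>

lemma of_rat_of_int_poly: "map_poly of_rat (of_int_poly p) = (of_int_poly p :: 'a :: field_char_0 poly)"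
  by (rule poly_eqI) (simp add: coeff_map_poly)

lemma rat_poly_clear_denominators:
  fixes p :: "rat poly"
  obtains m q where "m > (0 :: int)" "Polynomial.smult (of_int m) p = of_int_poly q"
proof -
  have "\<exists>m q. m > (0 :: int) \<and> Polynomial.smult (of_int m) p = of_int_poly q"
  proof (induction p)
    case 0
    show ?case by (intro exI[of _ 1] exI[of _ 0]) simp
  next
    case (pCons a p)
    then obtain m q where mq: "m > 0" "Polynomial.smult (of_int m) p = of_int_poly q" by blast
    obtain u v where uv: "quotient_of a = (u, v)" by fastforce
    then have v: "v > 0" "a = of_int u / of_int v"
      using quotient_of_denom_pos quotient_of_div by blast+
    have "Polynomial.smult (of_int (m * v)) (pCons a p) = 
       pCons (of_int (m * u)) (Polynomial.smult (of_int v) (Polynomial.smult (of_int m) p))"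
      using v by (simp add: mult.commute)
    also have "\<dots> = of_int_poly (pCons (m * u) (Polynomial.smult v q))"
      by (simp add: mq of_int_hom.map_poly_hom_smult of_int_hom.map_poly_pCons_hom)
    finally show ?case using mq v by (intro exI[of _ "m * v"] exI) auto
  qed
  then show ?thesis using that by blast
qed

lemma poly_of_rat_clear_denominators:
  fixes \<theta> :: complex
  obtains m q where "m > (0 :: int)" "of_int m * poly (map_poly of_rat p) \<theta> = poly (of_int_poly q) \<theta>"
proof -
  obtain m q where mq: "m > (0 :: int)" "Polynomial.smult (of_int m) p = of_int_poly q"
    by (rule rat_poly_clear_denominators)
  have "poly (map_poly of_rat (Polynomial.smult (of_int m) p)) \<theta> = of_int m * poly (map_poly of_rat p) \<theta>"
    by (simp add: of_rat_hom.map_poly_hom_smult)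
  then have "of_int m * poly (map_poly of_rat p) \<theta> = poly (of_int_poly q) \<theta>"
    by (simp add: mq of_rat_of_int_poly)
  with mq show ?thesis by (intro that)
qed

text \<open>A monic polynomial of least degree vanishing at \<open>x\<close> has nonzero constant
  term, since otherwise a factor \<open>x\<close> could be cancelled. Isolating that term exhibits
  it as a multiple of \<open>x\<close>, so denominators can be replaced by integers.\<close>

lemma algebraic_int_nonzero_dvd_int:
  fixes x :: complex
  assumes "algebraic_int x" "x \<noteq> 0"
  obtains r m where "m \<noteq> 0" "x * poly (of_int_poly r) x = of_int m"
proof -
  define Q where "Q p \<longleftrightarrow> monic p \<and> poly (of_int_poly p) x = 0" for p :: "int poly"
  have "\<exists>p. Q p" using assms unfolding algebraic_int_altdef_ipoly Q_def by blast
  then obtain p where p: "Q p" and min: "\<And>q. Q q \<Longrightarrow> degree p \<le> degree q"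
    using ex_has_least_nat[of Q _ degree] by blast
  obtain k r where pk: "p = pCons k r" by (cases p)
  have eq: "of_int k + x * poly (of_int_poly r) x = 0" using p unfolding Q_def pk ipoly_simps by blast
  have "r \<noteq> 0" using p by (auto simp: Q_def pk)
  have "k \<noteq> 0"
  proof
    assume "k = 0"
    then have "Q r" using p eq assms \<open>r \<noteq> 0\<close> by (simp add: Q_def pk)
    then show False using min[of r] \<open>r \<noteq> 0\<close> by (simp add: pk)
  qed
  moreover have "x * poly (of_int_poly r) x = of_int (- k)" using eq by (simp add: add_eq_0_iff)
  ultimately show ?thesis by (intro that[of "- k" r]) auto
qed

text \<open>The denominator \<open>y\<close> is a polynomial in \<open>\<theta>\<close> with
  \<open>y * r(y) = m\<close> for an integer \<open>m\<close>. As \<open>r(y)\<close> is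
  \<open>r\<close> composed with that polynomial, the numerator becomes a polynomial in
  \<open>\<theta>\<close> too.\<close>

lemma Qadj_clear_denominators:
  assumes "algebraic_int \<theta>" "x \<in> Qadj \<theta>"
  obtains m h where "m \<noteq> (0 :: int)" "of_int m * x = poly (of_int_poly h) \<theta>"
proof -
  obtain p q :: "rat poly" where x: "x = poly (map_poly of_rat p) \<theta> / poly (map_poly of_rat q) \<theta>"
    and q0: "poly (map_poly of_rat q) \<theta> \<noteq> 0"
    using assms by (auto simp: Qadj_def)
  obtain a p' where a: "a > (0 :: int)" "of_int a * poly (map_poly of_rat p) \<theta> = poly (of_int_poly p') \<theta>"
    by (rule poly_of_rat_clear_denominators)
  obtain b q' where b: "b > (0 :: int)" "of_int b * poly (map_poly of_rat q) \<theta> = poly (of_int_poly q') \<theta>"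
    by (rule poly_of_rat_clear_denominators)
  define y where "y = poly (of_int_poly q') \<theta>"
  have "y \<noteq> 0" using b(1) q0 unfolding y_def b(2)[symmetric] by simp
  have "algebraic_int y" unfolding y_def by (rule algebraic_int_poly[OF assms(1)])
  obtain r m where rm: "m \<noteq> 0" "y * poly (of_int_poly r) y = of_int m"
    by (rule algebraic_int_nonzero_dvd_int[OF \<open>algebraic_int y\<close> \<open>y \<noteq> 0\<close>])
  have "of_int (a * m) * x = of_int b * poly (of_int_poly p') \<theta> * poly (of_int_poly r) y"
  proof -
    have "poly (map_poly of_rat p) \<theta> = poly (of_int_poly p') \<theta> / of_int a"
      "poly (map_poly of_rat q) \<theta> = y / of_int b"
      unfolding y_def a(2)[symmetric] b(2)[symmetric] using a(1) b(1) by simp_all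
    then have x': "x = poly (of_int_poly p') \<theta> / of_int a / (y / of_int b)" by (simp only: x)
    have aux: "A * (y * R) * (P / A / (y / B)) = B * P * R" if "A \<noteq> 0" for A B P R
      using that \<open>y \<noteq> 0\<close> by (simp add: field_simps)
    have "of_int (a * m) * x = of_int a * (y * poly (of_int_poly r) y) * x" by (simp add: rm(2))
    also have "\<dots> = of_int b * poly (of_int_poly p') \<theta> * poly (of_int_poly r) y"
      unfolding x' by (rule aux) (use a(1) in simp)
    finally show ?thesis .
  qed
  also have "\<dots> = poly (of_int_poly ([:b:] * p' * pcompose r q')) \<theta>"
    by (simp add: ipoly_simps y_def of_int_hom.map_poly_pcompose poly_pcompose)
  finally show ?thesis using a rm by (intro that[of "a * m"]) auto
qed

text \<open>For an integral \<open>x\<close> some nonzero integer multiple \<open>m * x\<close> is a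
  polynomial in \<open>\<theta>\<close>; \<open>max\<close> strips the prime factors off
  \<open>m\<close> one at a time until \<open>m\<close> is a unit.\<close>

lemma ring_of_integers_eq_Zadj:
  fixes g :: "int poly"
  assumes g: "monic g" "poly (of_int_poly g) \<theta> = 0"
    and max: "\<And>p h. prime (p :: int) \<Longrightarrow> algebraic_int (poly (of_int_poly h) \<theta> / of_int p) \<Longrightarrow>
      \<exists>h'. poly (of_int_poly h) \<theta> = of_int p * poly (of_int_poly h') \<theta>"
  shows "Zadj \<theta> = ring_of_integers (Qadj \<theta>)"
proof
  have \<theta>: "algebraic_int \<theta>" using g unfolding algebraic_int_altdef_ipoly by blast
  show "Zadj \<theta> \<subseteq> ring_of_integers (Qadj \<theta>)"
  proof
    fix x assume "x \<in> Zadj \<theta>"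
    then obtain p where p: "x = poly (of_int_poly p) \<theta>" by (auto simp: Zadj_def)
    then have "x = poly (map_poly of_rat (of_int_poly p)) \<theta> / poly (map_poly of_rat 1) \<theta>
      \<and> poly (map_poly of_rat 1) \<theta> \<noteq> 0" by (simp add: of_rat_of_int_poly)
    then have "x \<in> Qadj \<theta>" unfolding Qadj_def by blast
    then show "x \<in> ring_of_integers (Qadj \<theta>)"
      using p algebraic_int_poly[OF \<theta>] by (simp add: ring_of_integers_def)
  qed
  show "ring_of_integers (Qadj \<theta>) \<subseteq> Zadj \<theta>"
  proof
    fix x assume "x \<in> ring_of_integers (Qadj \<theta>)"
    then have x: "x \<in> Qadj \<theta>" "algebraic_int x" by (auto simp: ring_of_integers_def)
    obtain m h where m: "m \<noteq> (0 :: int)" "of_int m * x = poly (of_int_poly h) \<theta>"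
      by (rule Qadj_clear_denominators[OF \<theta> x(1)])
    have "m \<noteq> 0 \<Longrightarrow> (\<exists>h. of_int m * x = poly (of_int_poly h) \<theta>) \<Longrightarrow> x \<in> Zadj \<theta>"
    proof (induction m rule: prime_divisors_induct)
      case (unit m)
      then obtain h where h: "of_int m * x = poly (of_int_poly h) \<theta>" by blast
      have "m * m = 1" using unit by (auto simp: zdvd1_eq abs_if split: if_splits)
      then have "x = of_int (m * m) * x" by simp
      also have "\<dots> = poly (of_int_poly ([:m:] * h)) \<theta>" using h by (simp add: ipoly_simps)
      finally show ?case unfolding Zadj_def by blast
    next
      case (factor p m)
      then obtain h where h: "of_int (p * m) * x = poly (of_int_poly h) \<theta>" by blast
      have "p \<noteq> 0" using factor by auto
      then have "poly (of_int_poly h) \<theta> / of_int p = of_int m * x" by (simp flip: h)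
      moreover have "algebraic_int (of_int m * x)" using x by (intro algebraic_int_add_mult) auto
      ultimately obtain h' where "poly (of_int_poly h) \<theta> = of_int p * poly (of_int_poly h') \<theta>"
        using max[OF factor(1)] by metis
      then have "of_int m * x = poly (of_int_poly h') \<theta>" using h \<open>p \<noteq> 0\<close> by simp
      then show ?case using factor \<open>p \<noteq> 0\<close> by auto
    qed auto
    then show "x \<in> Zadj \<theta>" using m by blast
  qed
qed

section \<open>The trinomials\<close>

definition disc_factor :: "nat \<Rightarrow> int \<Rightarrow> int \<Rightarrow> int" where
  "disc_factor n c d = int n ^ n * d + (- 1) ^ (n - 1) * (int n - 1) ^ (n - 1) * c ^ (n - 1)"

lemma coeff_gpoly:
  "n > 2 \<Longrightarrow> coeff (gpoly n c d) i = (if i = n then 1 else if i = n - 1 then c else if i = 0 then c * d else 0)"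
  by (auto simp: gpoly_def coeff_pCons split: nat.splits)

lemma degree_gpoly: "n > 2 \<Longrightarrow> degree (gpoly n c d) = n"
  by (rule antisym, rule degree_le) (auto simp: coeff_gpoly intro!: le_degree)

lemma monic_gpoly: "n > 2 \<Longrightarrow> monic (gpoly n c d)"
  by (simp add: degree_gpoly coeff_gpoly)

lemma poly_gpoly: "n > 0 \<Longrightarrow> poly (gpoly n c d) x = x ^ (n - 1) * (x + c) + c * d"
  by (cases n) (auto simp: gpoly_def poly_monom algebra_simps)

lemma pderiv_gpoly:
  assumes "n > 2" shows "pderiv (gpoly n c d) = [:0, 1:] ^ (n - 2) * [:c * (int n - 1), int n:]"
proof -
  have "n - 1 = Suc (n - 2)" "int (n - 2) = int n - 2" using assms by auto
  then show ?thesis using assms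
    unfolding poly_eq_poly_eq_iff[symmetric] by (intro ext) (simp add: gpoly_def pderiv_add pderiv_monom pderiv_pCons poly_monom algebra_simps)
qed

text \<open>In \<open>n^n g(a) = (n a)^(n-1) (n a + n c) + n^n c d\<close> the substitution
  \<open>n a = - c (n - 1)\<close> turns \<open>n a + n c\<close> into \<open>c\<close>. It is
  applied with a modulus \<open>p^2\<close>.\<close>

lemma gpoly_critical_value:
  assumes n: "n > 2" and a: "[int n * a = - c * (int n - 1)] (mod m)"
  shows "[int n ^ n * poly (gpoly n c d) a = c * disc_factor n c d] (mod m)"
proof -
  let ?N = "int n"
  have nn: "n = Suc (n - 1)" using n by simp
  have "?N ^ n * poly (gpoly n c d) a = (?N * a) ^ (n - 1) * (?N * a + ?N * c) + ?N ^ n * (c * d)"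
  proof -
    have "?N ^ n = ?N * ?N ^ (n - 1)" using nn by (metis power_Suc)
    then show ?thesis using n by (simp add: poly_gpoly power_mult_distrib algebra_simps)
  qed
  also have "[\<dots> = (- c * (?N - 1)) ^ (n - 1) * (- c * (?N - 1) + ?N * c) + ?N ^ n * (c * d)] (mod m)"
    by (intro cong_add cong_mult cong_pow a cong_refl)
  also have "(- c * (?N - 1)) ^ (n - 1) * (- c * (?N - 1) + ?N * c) + ?N ^ n * (c * d)
     = c * disc_factor n c d"
  proof -
    have "(- c * (?N - 1)) ^ (n - 1) = (- 1) ^ (n - 1) * (?N - 1) ^ (n - 1) * c ^ (n - 1)"
      by (simp add: power_mult_distrib[symmetric] algebra_simps)
    then show ?thesis by (simp add: disc_factor_def algebra_simps)
  qed
  finally show ?thesis .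
qed

text \<open>Eisenstein's criterion at a prime \<open>p\<close> dividing \<open>c\<close>: as
  \<open>c\<close> is square-free and coprime to \<open>d\<close>, \<open>p\<close> divides
  \<open>c * d\<close> exactly once.\<close>

lemma gpoly_irreducible:
  assumes n: "n > 2" and c: "squarefree c" "\<not> is_unit c" "c \<noteq> 0" and d: "coprime c d"
  shows "irreducible (gpoly n c d)"
proof -
  obtain p where p: "prime p" "p dvd c" using c prime_divisor_exists by blast
  have pd: "\<not> p dvd d" using p d by (meson coprime_common_divisor not_prime_unit)
  have p2: "\<not> p\<^sup>2 dvd c * d"
  proof
    assume "p\<^sup>2 dvd c * d"
    moreover have "coprime (p\<^sup>2) d" using pd p prime_imp_coprime by (simp add: prime_imp_coprime)
    ultimately have "p\<^sup>2 dvd c" using coprime_dvd_mult_left_iff by blast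
    then show False using c p by (meson not_prime_unit squarefreeD)
  qed
  let ?g = "gpoly n c d"
  \<comment> \<open>At the first index \<open>i\<close> where the coefficient of \<open>a\<close> is
    prime to \<open>p\<close>, that of the product is prime to \<open>p\<close> as well. This forces
    \<open>i = n\<close>, and \<open>b\<close> is constant.\<close>
  have unit: "is_unit b" if ab: "?g = a * b" and b0: "\<not> p dvd coeff b 0" for a b
  proof -
    have "lead_coeff a * lead_coeff b = 1"
      using monic_gpoly[OF n, of c d] by (simp add: ab lead_coeff_mult)
    then have la: "is_unit (lead_coeff a)" and lb: "is_unit (lead_coeff b)"
      by (metis dvd_triv_left dvd_triv_right)+
    then have ex: "\<not> p dvd lead_coeff a" using p by (meson dvd_trans not_prime_unit)
    define i where "i = (LEAST i. \<not> p dvd coeff a i)"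
    have i: "\<not> p dvd coeff a i" unfolding i_def by (rule LeastI[of _ "degree a"]) (rule ex)
    have below: "p dvd coeff a j" if "j < i" for j
      using that not_less_Least unfolding i_def by blast
    have "coeff ?g i = coeff a i * coeff b 0 + (\<Sum>j<i. coeff a j * coeff b (i - j))"
      by (simp add: ab coeff_mult lessThan_Suc_atMost[symmetric])
    moreover have "p dvd (\<Sum>j<i. coeff a j * coeff b (i - j))"
      using below by (intro dvd_sum) auto
    moreover have "\<not> p dvd coeff a i * coeff b 0" using i b0 p by (simp add: prime_dvd_mult_iff)
    ultimately have "\<not> p dvd coeff ?g i" by (metis dvd_add_left_iff)
    then have "i = n" using p n by (auto simp: coeff_gpoly split: if_splits)
    then have "n \<le> degree a" using i by (intro le_degree) auto
    moreover have "a \<noteq> 0" "b \<noteq> 0" using la lb by auto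
    then have "degree a + degree b = n" using degree_gpoly[OF n, of c d] by (simp add: ab degree_mult_eq)
    ultimately have "degree b = 0" by simp
    then obtain k where "b = [:k:]" by (rule degree_eq_zeroE)
    then show ?thesis using lb by (simp add: is_unit_const_poly_iff)
  qed
  show ?thesis
  proof (rule irreducibleI)
    show "?g \<noteq> 0" using degree_gpoly[OF n, of c d] n by auto
    show "\<not> is_unit ?g" using degree_gpoly[OF n, of c d] n by (auto simp: is_unit_poly_iff)
    fix a b assume ab: "?g = a * b"
    have "coeff a 0 * coeff b 0 = c * d" using n by (simp add: coeff_gpoly flip: coeff_mult_0 ab)
    then have "\<not> p dvd coeff a 0 \<or> \<not> p dvd coeff b 0"
      using p2 mult_dvd_mono[of p "coeff a 0" p "coeff b 0"] by (auto simp: power2_eq_square)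
    then show "is_unit a \<or> is_unit b" using unit[of a b] unit[of b a] ab by (auto simp: mult.commute)
  qed
qed

text \<open>This supplies the hypothesis \<open>double\<close> of \<open>dedekind_criterion\<close>.
  The derivative \<open>x^(n-2) (n x + c (n-1))\<close> lies in \<open>P\<close>, so either
  \<open>x\<close> does, and \<open>a = 0\<close> works because \<open>g(0) = c d\<close> is
  square-free, or the linear factor does, and \<open>a\<close> is its root modulo
  \<open>p^2\<close>.\<close>

lemma gpoly_double_root:
  fixes p :: int
  assumes n: "n > 2" and p: "prime p" and cd: "squarefree (c * d)"
    and disc: "\<not> p dvd int n * c \<Longrightarrow> \<not> p\<^sup>2 dvd disc_factor n c d"
    and P: "ring_ideal P" "1 \<notin> P" "\<And>a b. a * b \<in> P \<Longrightarrow> a \<in> P \<or> b \<in> P" "[:p:] \<in> P"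
    and g: "gpoly n c d \<in> P" "pderiv (gpoly n c d) \<in> P"
  shows "\<exists>a. [:- a, 1:] \<in> P \<and> \<not> p\<^sup>2 dvd poly (gpoly n c d) a"
proof -
  note PD = ring_idealD[OF P(1)]
  have pow: "f \<in> P" if "f ^ k \<in> P" for f k
    using that P(2,3) by (induction k) auto
  show ?thesis
  proof (cases "[:0, 1:] \<in> P")
    case True
    have "\<not> p\<^sup>2 dvd c * d" using cd p by (meson not_prime_unit squarefreeD)
    then show ?thesis using True n by (intro exI[of _ 0]) (simp add: poly_gpoly power_0_left)
  next
    case False
    then have L: "[:c * (int n - 1), int n:] \<in> P"
      using g(2) pow P(3) unfolding pderiv_gpoly[OF n] by blast
    \<comment> \<open>If \<open>p\<close> divided \<open>c\<close>, then \<open>g\<close> would be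
      \<open>x ^ n\<close> modulo \<open>p\<close>, putting \<open>x\<close> into
      \<open>P\<close>.\<close>
    have pc: "\<not> p dvd c"
    proof
      assume "p dvd c"
      then obtain k where k: "c = p * k" by (auto elim: dvdE)
      have "gpoly n c d - [:p:] * ([:k:] * [:0, 1:] ^ (n - 1) + [:k * d:]) = [:0, 1:] ^ n"
      proof -
        have "n = Suc (n - 1)" using n by simp
        then show ?thesis
          unfolding poly_eq_poly_eq_iff[symmetric]
          by (intro ext) (use n in \<open>simp add: poly_gpoly k algebra_simps flip: power_Suc\<close>)
      qed
      moreover have "gpoly n c d - [:p:] * ([:k:] * [:0, 1:] ^ (n - 1) + [:k * d:]) \<in> P"
        by (intro PD(4,5) g(1) P(4))
      ultimately show False using pow False by metis
    qed
    \<comment> \<open>If \<open>p\<close> divided \<open>n\<close>, the linear factor would reduce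
      to the constant \<open>- c\<close> modulo \<open>p\<close>.\<close>
    have pn: "\<not> p dvd int n"
    proof
      assume "p dvd int n"
      then obtain k where k: "int n = p * k" by (auto elim: dvdE)
      have "[:c * (int n - 1), int n:] - [:p:] * [:c * k, k:] \<in> P" by (intro PD(4,5) L P(4))
      also have "[:c * (int n - 1), int n:] - [:p:] * [:c * k, k:] = [:- c:]"
        by (simp add: k algebra_simps)
      finally have "p dvd - c" by (rule prime_ideal_int_const[OF P(1,2) p P(4)])
      then show False using pc by simp
    qed
    then have "coprime (int n) (p\<^sup>2)" using p prime_imp_coprime by (simp add: coprime_commute)
    \<comment> \<open>The root is taken modulo \<open>p^2\<close>, not just \<open>p\<close>, so
      that \<open>gpoly_critical_value\<close> relates \<open>g(a)\<close> to
      \<open>disc_factor\<close> modulo \<open>p^2\<close>.\<close>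
    then obtain b where "[int n * b = 1] (mod p\<^sup>2)" using cong_solve_coprime_int by blast
    define a where "a = b * (- c * (int n - 1))"
    have "[int n * b * (- c * (int n - 1)) = 1 * (- c * (int n - 1))] (mod p\<^sup>2)"
      by (intro cong_mult cong_refl) fact
    then have a: "[int n * a = - c * (int n - 1)] (mod p\<^sup>2)" by (simp add: a_def mult.assoc)
    then have "p\<^sup>2 dvd int n * a - (- c * (int n - 1))" by (simp add: cong_iff_dvd_diff)
    then have "p dvd int n * a + c * (int n - 1)"
      by (metis dvd_trans dvd_triv_left power2_eq_square diff_minus_eq_add mult_minus_left)
    then obtain k where k: "int n * a + c * (int n - 1) = p * k" by (auto elim: dvdE)
    have "[:c * (int n - 1), int n:] - [:p:] * [:k:] \<in> P" by (intro PD(4,5) L P(4))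
    also have "[:c * (int n - 1), int n:] - [:p:] * [:k:] = [:int n:] * [:- a, 1:]"
      using k by (simp add: algebra_simps)
    finally have "[:int n:] \<in> P \<or> [:- a, 1:] \<in> P" by (rule P(3))
    then have aP: "[:- a, 1:] \<in> P"
      using prime_ideal_int_const[OF P(1,2) p P(4)] pn by blast
    have "\<not> p\<^sup>2 dvd poly (gpoly n c d) a"
    proof
      assume "p\<^sup>2 dvd poly (gpoly n c d) a"
      then have "p\<^sup>2 dvd c * disc_factor n c d"
        using cong_dvd_iff[OF gpoly_critical_value[OF n a, of d]] by simp
      moreover have "coprime (p\<^sup>2) c" using pc p prime_imp_coprime by simp
      ultimately have "p\<^sup>2 dvd disc_factor n c d" using coprime_dvd_mult_right_iff by blast
      then show False using disc pc pn p by (simp add: prime_dvd_mult_iff)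
    qed
    then show ?thesis using aP by blast
  qed
qed

lemma monogenic_if_squarefree:
  assumes n: "n > 2" and c: "squarefree c" "\<not> is_unit c" and d: "squarefree d" "coprime c d"
    and disc: "\<And>p. prime p \<Longrightarrow> \<not> p dvd int n * c \<Longrightarrow> \<not> p\<^sup>2 dvd disc_factor n c d"
  shows "d \<in> monogenic_d n c"
proof -
  have c0: "c \<noteq> 0" using c by auto
  have irr: "irreducible (gpoly n c d)" using gpoly_irreducible[OF n c c0 d(2)] .
  have cd: "squarefree (c * d)" using c d by (simp add: squarefree_mult_coprime)
  have "Zadj \<theta> = ring_of_integers (Qadj \<theta>)" if root: "poly (of_int_poly (gpoly n c d)) \<theta> = 0" for \<theta>
  proof (rule ring_of_integers_eq_Zadj[OF monic_gpoly[OF n] root])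
    fix p :: int and h
    assume p: "prime p" and int: "algebraic_int (poly (of_int_poly h) \<theta> / of_int p)"
    show "\<exists>h'. poly (of_int_poly h) \<theta> = of_int p * poly (of_int_poly h') \<theta>"
      by (rule dedekind_criterion[OF irr _ monic_gpoly[OF n] root p gpoly_double_root[OF n p cd disc[OF p]] int])
        (use n in \<open>auto simp: degree_gpoly\<close>)
  qed
  then show ?thesis using irr by (simp add: monogenic_d_def)
qed

section \<open>Counting integers by residues\<close>

text \<open>Sieving one prime at a time: the terms at multiples of \<open>p\<close> sum to
  \<open>1 / p^2\<close> times the previous total, because
  \<open>h (p * n) = f n / p^2\<close>.\<close>

lemma sums_inverse_squares_coprime:
  fixes P :: "nat set"
  assumes "finite P" "\<And>p. p \<in> P \<Longrightarrow> prime p"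
  shows "(\<lambda>n. if n > 0 \<and> (\<forall>p\<in>P. \<not> p dvd n) then 1 / real n ^ 2 else 0) sums
     ((\<Prod>p\<in>P. 1 - 1 / real p ^ 2) * (pi\<^sup>2 / 6))"
  using assms
proof (induction P rule: finite_induct)
  case empty
  have "(\<lambda>n. if Suc n > 0 then 1 / real (Suc n) ^ 2 else 0) sums (pi\<^sup>2 / 6)"
    using inverse_squares_sums by simp
  then have "(\<lambda>n. if n > 0 then 1 / real n ^ 2 else 0) sums (pi\<^sup>2 / 6 + 0)"
    by (subst (asm) sums_Suc_iff) simp
  then show ?case by simp
next
  case (insert p P)
  define f where "f n = (if n > 0 \<and> (\<forall>p\<in>P. \<not> p dvd n) then 1 / real n ^ 2 else 0)" for n
  define s where "s = (\<Prod>p\<in>P. 1 - 1 / real p ^ 2) * (pi\<^sup>2 / 6)"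
  have f: "f sums s" using insert.IH insert.prems unfolding f_def[abs_def] s_def by blast
  have p: "prime p" "p > 0" using insert by (auto simp: prime_gt_0_nat)
  define h where "h n = (if p dvd n then f n else 0)" for n
  have hp: "h (p * n) = f n / real p ^ 2" for n
  proof -
    have "q dvd p * n \<longleftrightarrow> q dvd n" if "q \<in> P" for q
    proof -
      have q: "prime q" "q \<noteq> p" using insert that by auto
      then have "\<not> q dvd p" using p primes_dvd_imp_eq by blast
      then show ?thesis using q by (simp add: prime_dvd_mult_iff)
    qed
    then show ?thesis using p by (auto simp: h_def f_def power_mult_distrib)
  qed
  have "(\<lambda>n. h (p * n)) sums (s / real p ^ 2)"
    unfolding hp by (rule sums_divide[OF f])
  then have "h sums (s / real p ^ 2)"
    by (subst (asm) sums_mono_reindex) (use p in \<open>auto simp: strict_mono_def h_def elim!: dvdE\<close>)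
  from sums_diff[OF f this] have "(\<lambda>n. f n - h n) sums (s - s / real p ^ 2)" .
  also have "(\<lambda>n. f n - h n) = (\<lambda>n. if n > 0 \<and> (\<forall>q\<in>insert p P. \<not> q dvd n) then 1 / real n ^ 2 else 0)"
    by (auto simp: f_def h_def)
  also have "s - s / real p ^ 2 = (\<Prod>p\<in>insert p P. 1 - 1 / real p ^ 2) * (pi\<^sup>2 / 6)"
    using insert by (simp add: s_def algebra_simps)
  finally show ?case .
qed

text \<open>All terms of the sieved series are nonnegative and the one at 1 survives, so its sum is
  at least 1.\<close>

lemma euler_product_bound:
  fixes P :: "nat set"
  assumes "finite P" "\<And>p. p \<in> P \<Longrightarrow> prime p"
  shows "6 / pi\<^sup>2 \<le> (\<Prod>p\<in>P. 1 - 1 / real p ^ 2)"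
proof -
  let ?f = "\<lambda>n. if n > 0 \<and> (\<forall>p\<in>P. \<not> p dvd n) then 1 / real n ^ 2 else 0"
  have s: "?f sums ((\<Prod>p\<in>P. 1 - 1 / real p ^ 2) * (pi\<^sup>2 / 6))"
    by (rule sums_inverse_squares_coprime[OF assms])
  have "\<not> p dvd 1" if "p \<in> P" for p using assms(2)[OF that] not_prime_unit by blast
  then have "1 = sum ?f {1}" by simp
  also have "\<dots> \<le> suminf ?f" by (rule sum_le_suminf) (use s in \<open>auto simp: sums_iff\<close>)
  also have "\<dots> = (\<Prod>p\<in>P. 1 - 1 / real p ^ 2) * (pi\<^sup>2 / 6)" using s by (simp add: sums_iff)
  finally show ?thesis by (simp add: field_simps)
qed

section \<open>Periodic conditions and the Chinese remainder theorem\<close>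

lemma mod_bij_betw_interval:
  fixes a m :: int
  assumes "m > 0"
  shows "bij_betw (\<lambda>d. d mod m) {a..<a + m} {0..<m}"
proof -
  have "inj_on (\<lambda>d. d mod m) {a..<a + m}"
  proof (rule inj_onI)
    fix x y assume xy: "x \<in> {a..<a + m}" "y \<in> {a..<a + m}" "x mod m = y mod m"
    then have "m dvd x - y" by (simp add: mod_eq_dvd_iff)
    moreover have "\<bar>x - y\<bar> < m" using xy by auto
    ultimately show "x = y" using assms dvd_imp_le_int[of "x - y" m] by force
  qed
  moreover have "(\<lambda>d. d mod m) ` {a..<a + m} \<subseteq> {0..<m}" using assms by auto
  ultimately have "(\<lambda>d. d mod m) ` {a..<a + m} = {0..<m}"
    by (intro card_subset_eq) (auto simp: card_image)
  with \<open>inj_on _ _\<close> show ?thesis by (simp add: bij_betw_def)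
qed

lemma card_periodic_period:
  fixes a m :: int
  assumes "m > 0" "\<And>d. Q (d mod m) = Q d"
  shows "card {d \<in> {a..<a + m}. Q d} = card {d \<in> {0..<m}. Q d}"
proof (rule bij_betw_same_card)
  have b: "bij_betw (\<lambda>d. d mod m) {a..<a + m} {0..<m}" by (rule mod_bij_betw_interval[OF assms(1)])
  show "bij_betw (\<lambda>d. d mod m) {d \<in> {a..<a + m}. Q d} {d \<in> {0..<m}. Q d}"
    by (rule bij_betw_Collect[OF b]) (simp add: assms(2))
qed

lemma card_periodic_blocks:
  fixes a m :: int
  assumes "m > 0" "\<And>d. Q (d mod m) = Q d"
  shows "card {d \<in> {a..<a + int k * m}. Q d} = k * card {d \<in> {0..<m}. Q d}"
proof (induction k)
  case (Suc k)
  define b where "b = a + int k * m"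
  have ab: "a \<le> b" "b \<le> b + m" using assms(1) by (simp_all add: b_def)
  have eq: "a + int (Suc k) * m = b + m" by (simp add: b_def algebra_simps)
  have "{d \<in> {a..<a + int (Suc k) * m}. Q d} = {d \<in> {a..<b}. Q d} \<union> {d \<in> {b..<b + m}. Q d}"
    unfolding eq using ab by auto
  also have "card \<dots> = card {d \<in> {a..<b}. Q d} + card {d \<in> {b..<b + m}. Q d}"
    by (intro card_Un_disjoint finite_subset[OF Collect_restrict finite_atLeastLessThan_int]) auto
  finally show ?case using Suc unfolding b_def[symmetric] using card_periodic_period[where Q = Q, OF assms] by simp
qed simp

text \<open>The interval contains \<open>(2 * N + 1) div m\<close> full periods; the incomplete one
  left over costs at most \<open>m\<close>.\<close>

lemma card_periodic_symmetric_interval_ge: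
  fixes m :: int
  assumes "m > 0" "\<And>d. Q (d mod m) = Q d"
  shows "real (card {d. \<bar>d\<bar> \<le> int N \<and> Q d}) \<ge>
     (2 * real N + 1) * (real (card {d \<in> {0..<m}. Q d}) / of_int m) - of_int m"
proof -
  define r where "r = card {d \<in> {0..<m}. Q d}"
  define k where "k = nat ((2 * int N + 1) div m)"
  have k: "int k = (2 * int N + 1) div m" using assms by (simp add: k_def pos_imp_zdiv_nonneg_iff)
  have "int k * m \<le> 2 * int N + 1" unfolding k using assms by (simp add: div_mult2_eq minus_mod_eq_div_mult [symmetric])
  then have "{d \<in> {- int N..<- int N + int k * m}. Q d} \<subseteq> {d. \<bar>d\<bar> \<le> int N \<and> Q d}" by auto
  moreover have "finite {d. \<bar>d\<bar> \<le> int N \<and> Q d}"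
    by (rule finite_subset[of _ "{- int N..int N}"]) auto
  ultimately have "card {d \<in> {- int N..<- int N + int k * m}. Q d} \<le> card {d. \<bar>d\<bar> \<le> int N \<and> Q d}"
    by (intro card_mono)
  then have "k * r \<le> card {d. \<bar>d\<bar> \<le> int N \<and> Q d}"
    unfolding card_periodic_blocks[where Q = Q, OF assms] r_def .
  then have 1: "real k * real r \<le> real (card {d. \<bar>d\<bar> \<le> int N \<and> Q d})"
    by (metis of_nat_le_iff of_nat_mult)
  have "card {d \<in> {0..<m}. Q d} \<le> card {0..<m}" by (intro card_mono) auto
  then have rm: "real r \<le> of_int m" using assms by (simp add: r_def)
  have "2 * int N + 1 < (int k + 1) * m" unfolding k using assms
    by (metis mult.commute pos_mod_bound mult_div_mod_eq add_less_cancel_left distrib_left mult_1_right)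
  then have "real_of_int (2 * int N + 1) < real_of_int ((int k + 1) * m)" by (simp only: of_int_less_iff)
  then have "2 * real N + 1 \<le> (real k + 1) * of_int m" by simp
  then have "(2 * real N + 1) / of_int m \<le> real k + 1" using assms by (simp add: field_simps)
  then have "(2 * real N + 1) / of_int m * real r \<le> (real k + 1) * real r" by (intro mult_right_mono) auto
  then have "(2 * real N + 1) * (real r / of_int m) \<le> real k * real r + real r"
    by (simp only: times_divide_eq_left times_divide_eq_right distrib_right mult_1)
  then show ?thesis using 1 rm unfolding r_def by linarith
qed

lemma card_chinese_remainder:
  fixes m q :: int
  assumes m: "m > 0" and q: "q > 0" and co: "coprime m q"
    and Q: "\<And>d. Q (d mod m) = Q d" and R: "\<And>d. R (d mod q) = R d"
  shows "card {d \<in> {0..<m * q}. Q d \<and> R d} = card {d \<in> {0..<m}. Q d} * card {d \<in> {0..<q}. R d}"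
proof -
  let ?A = "{d \<in> {0..<m * q}. Q d \<and> R d}" and ?B = "{d \<in> {0..<m}. Q d} \<times> {d \<in> {0..<q}. R d}"
  let ?f = "\<lambda>d. (d mod m, d mod q)"
  have mq: "m * q > 0" using m q by simp
  have "bij_betw ?f ?A ?B"
    unfolding bij_betw_def
  proof (intro conjI equalityI subsetI)
    show "inj_on ?f ?A"
    proof (rule inj_onI)
      fix x y assume xy: "x \<in> ?A" "y \<in> ?A" "?f x = ?f y"
      then have "[x = y] (mod m)" "[x = y] (mod q)" by (auto simp: cong_def)
      then have "[x = y] (mod m * q)" using co by (rule coprime_cong_mult)
      then show "x = y" using xy by (auto simp: cong_def)
    qed
    fix z assume "z \<in> ?f ` ?A"
    then show "z \<in> ?B" using m q Q R by auto
  next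
    fix z assume "z \<in> ?B"
    then obtain u v where z: "z = (u, v)" "u \<in> {0..<m}" "v \<in> {0..<q}" "Q u" "R v" by auto
    obtain x where x: "[x = u] (mod m)" "[x = v] (mod q)" using binary_chinese_remainder_int[OF co] by blast
    define y where "y = x mod (m * q)"
    have "y mod m = x mod m" "y mod q = x mod q" by (simp_all add: y_def mod_mod_cancel)
    then have yf: "y mod m = u" "y mod q = v" using x z by (auto simp: cong_def)
    then have "Q y" "R y" using Q[of y] R[of y] z by auto
    moreover have "y \<in> {0..<m * q}" using mq by (simp add: y_def)
    ultimately show "z \<in> ?f ` ?A" using yf z by (intro image_eqI[of _ _ y]) auto
  qed
  then have "card ?A = card ?B" by (rule bij_betw_same_card)
  then show ?thesis by (simp only: card_cartesian_product)
qed

lemma card_chinese_remainder_prod: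
  fixes M :: "'i \<Rightarrow> int"
  assumes "finite P" "\<And>p. p \<in> P \<Longrightarrow> M p > 0"
    "\<And>p q. p \<in> P \<Longrightarrow> q \<in> P \<Longrightarrow> p \<noteq> q \<Longrightarrow> coprime (M p) (M q)"
    "\<And>p d. p \<in> P \<Longrightarrow> Q p (d mod M p) = Q p d"
  shows "card {d \<in> {0..<\<Prod>p\<in>P. M p}. \<forall>p\<in>P. Q p d} = (\<Prod>p\<in>P. card {d \<in> {0..<M p}. Q p d})"
  using assms
proof (induction P rule: finite_induct)
  case (insert p P)
  have "card {d \<in> {0..<M p * (\<Prod>p\<in>P. M p)}. Q p d \<and> (\<forall>p\<in>P. Q p d)}
    = card {d \<in> {0..<M p}. Q p d} * card {d \<in> {0..<\<Prod>p\<in>P. M p}. \<forall>p\<in>P. Q p d}"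
  proof (rule card_chinese_remainder)
    show "coprime (M p) (\<Prod>p\<in>P. M p)" using insert by (intro prod_coprime_right) auto
    show "(\<Prod>p\<in>P. M p) > 0" using insert by (intro prod_pos) auto
    fix d
    have "Q q (d mod (\<Prod>p\<in>P. M p)) = Q q d" if "q \<in> P" for q
    proof -
      have "M q dvd (\<Prod>p\<in>P. M p)" using insert that by (intro dvd_prodI) auto
      then have "d mod (\<Prod>p\<in>P. M p) mod M q = d mod M q" by (rule mod_mod_cancel)
      then show ?thesis using insert.prems(3)[of q] that by (metis insertI2)
    qed
    then show "(\<forall>p\<in>P. Q p (d mod (\<Prod>p\<in>P. M p))) = (\<forall>p\<in>P. Q p d)" by blast
  qed (use insert in auto)
  then show ?case using insert by simp
next
  case empty
  have "{d :: int. 0 \<le> d \<and> d < 1} = {0}" by auto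
  then show ?case by simp
qed

section \<open>Upper bounds for congruences and large square divisors\<close>

text \<open>All solutions lie in one residue class modulo \<open>m\<close>, so
  \<open>(d - a) div m\<close> separates them; \<open>d - a\<close> runs from 0 to \<open>L\<close>
  inclusive, whence the extra 1.\<close>

lemma card_linear_congruence_le:
  fixes K e m a :: int
  assumes m: "m > 0" "coprime m K"
  shows "card {d \<in> {a..a + int L}. m dvd K * d + e} \<le> L div nat m + 1"
proof -
  let ?S = "{d \<in> {a..a + int L}. m dvd K * d + e}"
  have "inj_on (\<lambda>d. nat ((d - a) div m)) ?S"
  proof (rule inj_onI)
    fix x y assume xy: "x \<in> ?S" "y \<in> ?S" "nat ((x - a) div m) = nat ((y - a) div m)"
    then have "m dvd (K * x + e) - (K * y + e)" by (intro dvd_diff) auto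
    then have "m dvd K * (x - y)" by (simp add: algebra_simps)
    then have "m dvd x - y" using m coprime_dvd_mult_right_iff by blast
    then have "m dvd (x - a) - (y - a)" by simp
    then have "(x - a) mod m = (y - a) mod m" by (simp add: mod_eq_dvd_iff)
    moreover have "(x - a) div m = (y - a) div m"
      using xy m by (simp add: nat_eq_iff pos_imp_zdiv_nonneg_iff split: if_splits)
    ultimately have "x - a = y - a" by (metis div_mult_mod_eq)
    then show "x = y" by simp
  qed
  moreover have "(\<lambda>d. nat ((d - a) div m)) ` ?S \<subseteq> {..L div nat m}"
  proof (intro image_subsetI)
    fix d assume "d \<in> ?S"
    then have "(d - a) div m \<le> int L div m" using m by (intro zdiv_mono1) auto
    also have "\<dots> = int (L div nat m)" using m by (simp add: zdiv_int)
    finally show "nat ((d - a) div m) \<in> {..L div nat m}" by (simp add: nat_le_iff)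
  qed
  ultimately have "card ?S \<le> card {..L div nat m}" by (intro card_inj_on_le) auto
  then show ?thesis by simp
qed

text \<open>Telescoping with \<open>1 / (k + 1)^2 \<le> 1 / k - 1 / (k + 1)\<close>.\<close>

lemma sum_inverse_squares_tail:
  assumes "Y > 0" shows "(\<Sum>k\<in>{Y<..T}. 1 / real k ^ 2) \<le> 1 / real Y"
proof (cases "Y \<le> T")
  case True
  have "(\<Sum>k\<in>{Y<..T}. 1 / real k ^ 2) \<le> 1 / real Y - 1 / real T"
    using True
  proof (induction T rule: dec_induct)
    case (step T)
    have T: "T > 0" using step assms by simp
    have "{Y<..Suc T} = insert (Suc T) {Y<..T}" using step by auto
    moreover have "1 / real (Suc T) ^ 2 \<le> 1 / real T - 1 / real (Suc T)"
    proof -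
      have "1 / real T - 1 / real (Suc T) = 1 / (real T * real (Suc T))" using T by (simp add: field_simps)
      moreover have "1 / real (Suc T) ^ 2 \<le> 1 / (real T * real (Suc T))"
        unfolding power2_eq_square using T by (intro divide_left_mono mult_right_mono) auto
      ultimately show ?thesis by simp
    qed
    ultimately show ?case using step.IH by simp
  qed simp
  also have "\<dots> \<le> 1 / real Y" by simp
  finally show ?thesis .
qed simp

text \<open>As \<open>p^2\<close> divides a nonzero number of absolute value at most
  \<open>T^2\<close>, only \<open>p \<le> T\<close> occur. Each contributes at most
  \<open>2 N / p^2 + 1\<close>; the fractions sum to at most \<open>2 N / Y\<close> and the ones to
  at most \<open>T\<close>. All integers \<open>p > Y\<close> coprime to \<open>K\<close> are
  counted, not only primes.\<close>

lemma card_large_square_divisor_le: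
  fixes K e :: int
  assumes Y: "Y > 0" and T: "\<bar>K\<bar> * int N + \<bar>e\<bar> \<le> int T ^ 2"
  shows "real (card {d. \<bar>d\<bar> \<le> int N \<and> K * d + e \<noteq> 0 \<and> (\<exists>p>Y. coprime (int p) K \<and> int p ^ 2 dvd K * d + e)})
    \<le> 2 * real N / real Y + real T"
proof -
  let ?S = "\<lambda>p. {d \<in> {- int N..- int N + int (2 * N)}. int p ^ 2 dvd K * d + e}"
  let ?I = "{p \<in> {Y<..T}. coprime (int p) K}"
  have "{d. \<bar>d\<bar> \<le> int N \<and> K * d + e \<noteq> 0 \<and> (\<exists>p>Y. coprime (int p) K \<and> int p ^ 2 dvd K * d + e)} \<subseteq> (\<Union>p\<in>?I. ?S p)"
  proof
    fix d assume "d \<in> {d. \<bar>d\<bar> \<le> int N \<and> K * d + e \<noteq> 0 \<and> (\<exists>p>Y. coprime (int p) K \<and> int p ^ 2 dvd K * d + e)}"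
    then obtain p where d: "\<bar>d\<bar> \<le> int N" "K * d + e \<noteq> 0" "p > Y" "coprime (int p) K" "int p ^ 2 dvd K * d + e" by blast
    have "int p ^ 2 \<le> \<bar>K * d + e\<bar>" using dvd_imp_le_int[OF d(2,5)] by simp
    also have "\<dots> \<le> \<bar>K\<bar> * \<bar>d\<bar> + \<bar>e\<bar>" by (metis abs_mult abs_triangle_ineq)
    also have "\<dots> \<le> \<bar>K\<bar> * int N + \<bar>e\<bar>" using d by (intro add_right_mono mult_left_mono) auto
    finally have "int p ^ 2 \<le> int T ^ 2" using T by linarith
    then have "p \<le> T" by (simp add: power2_le_iff_abs_le)
    then show "d \<in> (\<Union>p\<in>?I. ?S p)" using d by auto
  qed
  then have "card {d. \<bar>d\<bar> \<le> int N \<and> K * d + e \<noteq> 0 \<and> (\<exists>p>Y. coprime (int p) K \<and> int p ^ 2 dvd K * d + e)} \<le> card (\<Union>p\<in>?I. ?S p)"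
  proof (rule card_mono[rotated])
    have "finite (?S p)" for p
      by (rule finite_subset[of _ "{- int N..- int N + int (2 * N)}"]) auto
    then show "finite (\<Union>p\<in>?I. ?S p)" by (intro finite_UN_I) simp
  qed
  also have "\<dots> \<le> (\<Sum>p\<in>?I. card (?S p))" by (rule card_UN_le) simp
  also have "\<dots> \<le> (\<Sum>p\<in>?I. 2 * N div p ^ 2 + 1)"
  proof (rule sum_mono)
    fix p assume "p \<in> ?I"
    then have "int p ^ 2 > 0" "coprime (int p ^ 2) K" using Y by simp_all
    then have "card (?S p) \<le> 2 * N div nat (int p ^ 2) + 1"
      by (rule card_linear_congruence_le)
    then show "card (?S p) \<le> 2 * N div p ^ 2 + 1" by (simp add: nat_power_eq)
  qed
  also have "\<dots> \<le> (\<Sum>p\<in>{Y<..T}. 2 * N div p ^ 2 + 1)" by (intro sum_mono2) auto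
  finally have "real (card {d. \<bar>d\<bar> \<le> int N \<and> K * d + e \<noteq> 0 \<and> (\<exists>p>Y. coprime (int p) K \<and> int p ^ 2 dvd K * d + e)})
     \<le> real (\<Sum>p\<in>{Y<..T}. 2 * N div p ^ 2 + 1)" by (simp only: of_nat_le_iff)
  also have "\<dots> = (\<Sum>p\<in>{Y<..T}. real (2 * N div p ^ 2) + 1)" by (simp add: add.commute)
  also have "\<dots> \<le> (\<Sum>p\<in>{Y<..T}. 2 * real N * (1 / real p ^ 2) + 1)"
  proof (intro sum_mono add_right_mono)
    fix p
    have "real (2 * N div p ^ 2) \<le> real (2 * N) / real (p ^ 2)" by (rule of_nat_div_le_of_nat)
    then show "real (2 * N div p ^ 2) \<le> 2 * real N * (1 / real p ^ 2)" by simp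
  qed
  also have "\<dots> = 2 * real N * (\<Sum>p\<in>{Y<..T}. 1 / real p ^ 2) + real (T - Y)"
    by (simp add: sum.distrib sum_distrib_left)
  also have "\<dots> \<le> 2 * real N * (1 / real Y) + real T"
    by (intro add_mono mult_left_mono sum_inverse_squares_tail Y) auto
  finally show ?thesis by simp
qed

section \<open>Density\<close>

lemma card_non_solutions_ge:
  fixes q m K e :: int
  assumes q: "q > 0" "coprime q K" "q dvd m" and m: "m > 0"
  shows "real (card {d \<in> {0..<m}. \<not> q dvd K * d + e}) \<ge> of_int m * (1 - 1 / of_int q)"
proof -
  obtain k where k: "m = q * k" using q by (auto elim: dvdE)
  have k0: "k > 0" using k q m by (simp add: zero_less_mult_iff)
  \<comment> \<open>The \<open>m\<close> residues form an interval of length \<open>m - 1\<close>,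
    so \<open>card_linear_congruence_le\<close> gives exactly
    \<open>(m - 1) div q + 1 = m / q\<close>.\<close>
  have "(m - 1) div q = k - 1"
  proof -
    have "m - 1 = (q - 1) + (k - 1) * q" by (simp add: k algebra_simps)
    then have "(m - 1) div q = (q - 1) div q + (k - 1)" using q by (simp only: div_mult_self1)
    then show ?thesis using q by (simp add: div_pos_pos_trivial)
  qed
  moreover have "int (nat (m - 1) div nat q + 1) = (m - 1) div q + 1"
  proof -
    have "0 \<le> m - 1" "0 \<le> q" using m q by simp_all
    then show ?thesis by (simp only: of_nat_add of_nat_1 zdiv_int nat_0_le)
  qed
  ultimately have "nat (m - 1) div nat q + 1 = nat k" using k0 by linarith
  moreover have "{d \<in> {0..0 + int (nat (m - 1))}. q dvd K * d + e} = {d \<in> {0..<m}. q dvd K * d + e}"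
    using m by auto
  ultimately have le: "card {d \<in> {0..<m}. q dvd K * d + e} \<le> nat k"
    using card_linear_congruence_le[OF q(1,2), of 0 "nat (m - 1)" e] by simp
  have "card {0..<m} = card ({d \<in> {0..<m}. q dvd K * d + e} \<union> {d \<in> {0..<m}. \<not> q dvd K * d + e})"
    by (rule arg_cong[of _ _ card]) auto
  also have "\<dots> \<le> card {d \<in> {0..<m}. q dvd K * d + e} + card {d \<in> {0..<m}. \<not> q dvd K * d + e}"
    by (rule card_Un_le)
  finally have "nat m \<le> nat k + card {d \<in> {0..<m}. \<not> q dvd K * d + e}" using le by simp
  then have "real (nat m) \<le> real (nat k) + real (card {d \<in> {0..<m}. \<not> q dvd K * d + e})"
    by (simp only: of_nat_add[symmetric] of_nat_le_iff)
  moreover have "real (nat m) = of_int m" "real (nat k) = of_int k" using m k0 by simp_all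
  moreover have "of_int m * (1 - 1 / of_int q) = (of_int m - of_int k :: real)"
    using q by (simp add: k field_simps)
  ultimately show ?thesis by linarith
qed

section \<open>Local conditions and their densities\<close>

text \<open>Imposed at all primes, these conditions say that \<open>d\<close> is square-free and
  coprime to \<open>c\<close>. Each depends only on \<open>d\<close> modulo
  \<open>p^2\<close>.\<close>

definition good_coeff :: "int \<Rightarrow> nat \<Rightarrow> int \<Rightarrow> bool" where
  "good_coeff c p d \<longleftrightarrow> \<not> int p ^ 2 dvd d \<and> (int p dvd c \<longrightarrow> \<not> int p dvd d)"

definition good_disc :: "nat \<Rightarrow> int \<Rightarrow> nat \<Rightarrow> int \<Rightarrow> bool" where
  "good_disc n c p d \<longleftrightarrow> (\<not> int p dvd int n * c \<longrightarrow> \<not> int p ^ 2 dvd disc_factor n c d)"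

lemma good_coeff_mod: "good_coeff c p (d mod int p ^ 2) = good_coeff c p d"
  by (simp add: good_coeff_def dvd_mod_iff)

lemma good_disc_mod: "good_disc n c p (d mod int p ^ 2) = good_disc n c p d"
proof -
  have "[disc_factor n c (d mod int p ^ 2) = disc_factor n c d] (mod (int p ^ 2))"
    unfolding disc_factor_def by (intro cong_add cong_mult cong_refl) (simp add: cong_def)
  then show ?thesis by (simp add: good_disc_def cong_dvd_iff)
qed

text \<open>For \<open>p\<close> dividing \<open>c\<close> the proportion is \<open>1 - 1/p\<close>;
  written as \<open>(1 - 1/p^2) * p / (p + 1)\<close> it separates the Euler factor from the factor
  occurring in \<open>Bconst\<close>.\<close>

lemma card_good_coeff_ge:
  assumes p: "prime p"
  shows "real (card {d \<in> {0..<int p ^ 2}. good_coeff c p d})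
    \<ge> real p ^ 2 * ((1 - 1 / real p ^ 2) * (if int p dvd c then real p / (real p + 1) else 1))"
proof (cases "int p dvd c")
  case True
  have "int p dvd d" if "int p ^ 2 dvd d" for d
    using that by (metis dvd_trans dvd_triv_left power2_eq_square)
  then have "{d \<in> {0..<int p ^ 2}. good_coeff c p d} = {d \<in> {0..<int p ^ 2}. \<not> int p dvd 1 * d + 0}"
    using True by (simp add: good_coeff_def) blast
  moreover have "real (card {d \<in> {0..<int p ^ 2}. \<not> int p dvd 1 * d + 0})
    \<ge> of_int (int p ^ 2) * (1 - 1 / of_int (int p))"
    using prime_gt_0_nat[OF p] by (intro card_non_solutions_ge) auto
  moreover have "real p ^ 2 * ((1 - 1 / real p ^ 2) * (real p / (real p + 1))) = real p ^ 2 * (1 - 1 / real p)"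
  proof -
    have "real p ^ 2 * (1 - 1 / real p ^ 2) = (real p - 1) * (real p + 1)"
      using prime_gt_0_nat[OF p] by (simp add: field_simps power2_eq_square)
    then have "real p ^ 2 * ((1 - 1 / real p ^ 2) * (real p / (real p + 1))) = (real p - 1) * (real p + 1) * (real p / (real p + 1))"
      by (simp only: mult.assoc[symmetric])
    also have "\<dots> = (real p - 1) * real p" by simp
    also have "\<dots> = real p ^ 2 * (1 - 1 / real p)"
      using prime_gt_0_nat[OF p] by (simp add: field_simps power2_eq_square)
    finally show ?thesis .
  qed
  ultimately show ?thesis using True by simp
next
  case False
  have "{d \<in> {0..<int p ^ 2}. good_coeff c p d} = {d \<in> {0..<int p ^ 2}. \<not> int p ^ 2 dvd 1 * d + 0}"
    using False by (auto simp: good_coeff_def)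
  moreover have "real (card {d \<in> {0..<int p ^ 2}. \<not> int p ^ 2 dvd 1 * d + 0})
    \<ge> of_int (int p ^ 2) * (1 - 1 / of_int (int p ^ 2))"
    using prime_gt_0_nat[OF p] by (intro card_non_solutions_ge) auto
  ultimately show ?thesis using False by simp
qed

text \<open>For \<open>p\<close> dividing \<open>c\<close> but not \<open>n\<close> every residue is
  good, yet only \<open>1 - 1/p^2\<close> is claimed, in accordance with the second product of
  \<open>Bconst\<close>, which runs over the primes dividing \<open>n\<close>.\<close>

lemma card_good_disc_ge:
  assumes p: "prime p"
  shows "real (card {d \<in> {0..<int p ^ 2}. good_disc n c p d})
    \<ge> real p ^ 2 * (if p dvd n then 1 else 1 - 1 / real p ^ 2)"
proof (cases "int p dvd int n * c")
  case True
  then have "{d \<in> {0..<int p ^ 2}. good_disc n c p d} = {0..<int p ^ 2}" by (auto simp: good_disc_def)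
  then have "real (card {d \<in> {0..<int p ^ 2}. good_disc n c p d}) = real p ^ 2" by (simp add: nat_power_eq)
  then show ?thesis by (simp add: mult_left_le)
next
  case False
  then have pn: "\<not> p dvd n" by auto
  then have "coprime p n" using p by (simp add: prime_imp_coprime)
  then have "coprime (int p ^ 2) (int n ^ n)" by simp
  then have "real (card {d \<in> {0..<int p ^ 2}. \<not> int p ^ 2 dvd int n ^ n * d +
      (- 1) ^ (n - 1) * (int n - 1) ^ (n - 1) * c ^ (n - 1)})
    \<ge> of_int (int p ^ 2) * (1 - 1 / of_int (int p ^ 2))"
    using prime_gt_0_nat[OF p] by (intro card_non_solutions_ge) auto
  moreover have "{d \<in> {0..<int p ^ 2}. good_disc n c p d} = {d \<in> {0..<int p ^ 2}. \<not> int p ^ 2 dvd int n ^ n * d +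
      (- 1) ^ (n - 1) * (int n - 1) ^ (n - 1) * c ^ (n - 1)}"
    using False by (simp add: good_disc_def disc_factor_def)
  ultimately show ?thesis using pn by simp
qed

lemma prod_local_density_ge:
  fixes P :: "nat set" and Q :: "nat \<Rightarrow> int \<Rightarrow> bool"
  assumes P: "finite P" "\<And>p. p \<in> P \<Longrightarrow> prime p"
    and Q: "\<And>p d. p \<in> P \<Longrightarrow> Q p (d mod int p ^ 2) = Q p d"
    and a: "\<And>p. p \<in> P \<Longrightarrow> real (card {d \<in> {0..<int p ^ 2}. Q p d}) \<ge> real p ^ 2 * a p"
      "\<And>p. p \<in> P \<Longrightarrow> a p \<ge> 0"
  shows "real (card {d \<in> {0..<\<Prod>p\<in>P. int p ^ 2}. \<forall>p\<in>P. Q p d}) \<ge> of_int (\<Prod>p\<in>P. int p ^ 2) * (\<Prod>p\<in>P. a p)"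
proof -
  have "of_int (\<Prod>p\<in>P. int p ^ 2) * (\<Prod>p\<in>P. a p) = (\<Prod>p\<in>P. real p ^ 2 * a p)"
    by (simp add: prod.distrib)
  also have "\<dots> \<le> (\<Prod>p\<in>P. real (card {d \<in> {0..<int p ^ 2}. Q p d}))"
    using a by (intro prod_mono) auto
  also have "\<dots> = real (card {d \<in> {0..<\<Prod>p\<in>P. int p ^ 2}. \<forall>p\<in>P. Q p d})"
  proof (subst card_chinese_remainder_prod)
    show "coprime (int p ^ 2) (int q ^ 2)" if "p \<in> P" "q \<in> P" "p \<noteq> q" for p q
      using primes_coprime[of p q] P that by simp
    show "int p ^ 2 > 0" if "p \<in> P" for p using prime_gt_0_nat P that by simp
  qed (use P Q in auto)
  finally show ?thesis .
qed

text \<open>Each of the two families of conditions has at least the product of its local densities;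
  inclusion-exclusion inside one period yields the sum minus 1, the shape of
  \<open>Bconst\<close>.\<close>

lemma density_good_ge:
  fixes P :: "nat set"
  assumes P: "finite P" "\<And>p. p \<in> P \<Longrightarrow> prime p"
  defines "M \<equiv> \<Prod>p\<in>P. int p ^ 2"
  shows "real (card {d \<in> {0..<M}. \<forall>p\<in>P. good_coeff c p d \<and> good_disc n c p d}) / of_int M
    \<ge> (\<Prod>p\<in>P. (1 - 1 / real p ^ 2) * (if int p dvd c then real p / (real p + 1) else 1))
      + (\<Prod>p\<in>P. if p dvd n then 1 else 1 - 1 / real p ^ 2) - 1"
proof -
  let ?A = "{d \<in> {0..<M}. \<forall>p\<in>P. good_coeff c p d}" and ?B = "{d \<in> {0..<M}. \<forall>p\<in>P. good_disc n c p d}"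
  let ?a = "\<Prod>p\<in>P. (1 - 1 / real p ^ 2) * (if int p dvd c then real p / (real p + 1) else 1)"
  let ?b = "\<Prod>p\<in>P. if p dvd n then 1 else 1 - 1 / real p ^ 2"
  have M: "M > 0" unfolding M_def using P prime_gt_0_nat by (intro prod_pos) auto
  have ge0: "1 - 1 / real p ^ 2 \<ge> 0" if "p \<in> P" for p
    using prime_ge_1_nat[OF P(2)[OF that]] by (simp add: field_simps)
  have A: "real (card ?A) \<ge> of_int M * ?a"
    unfolding M_def using P ge0
    by (intro prod_local_density_ge card_good_coeff_ge good_coeff_mod) auto
  have B: "real (card ?B) \<ge> of_int M * ?b"
    unfolding M_def using P ge0
    by (intro prod_local_density_ge card_good_disc_ge good_disc_mod) auto
  have fin: "finite ?A" "finite ?B"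
    by (rule finite_subset[OF Collect_restrict finite_atLeastLessThan_int])+
  have "card ?A + card ?B = card (?A \<union> ?B) + card (?A \<inter> ?B)" by (rule card_Un_Int[OF fin])
  moreover have "card (?A \<union> ?B) \<le> card {0..<M}" by (rule card_mono) auto
  moreover have "?A \<inter> ?B = {d \<in> {0..<M}. \<forall>p\<in>P. good_coeff c p d \<and> good_disc n c p d}" by auto
  ultimately have "card ?A + card ?B \<le> nat M + card {d \<in> {0..<M}. \<forall>p\<in>P. good_coeff c p d \<and> good_disc n c p d}"
    by simp
  then have "real (card ?A) + real (card ?B)
      \<le> real (nat M) + real (card {d \<in> {0..<M}. \<forall>p\<in>P. good_coeff c p d \<and> good_disc n c p d})"
    by (simp only: of_nat_add[symmetric] of_nat_le_iff)
  then have "of_int M * ?a + of_int M * ?b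
      \<le> of_int M + real (card {d \<in> {0..<M}. \<forall>p\<in>P. good_coeff c p d \<and> good_disc n c p d})"
    using A B M by simp
  then have "of_int M * (?a + ?b - 1) \<le> real (card {d \<in> {0..<M}. \<forall>p\<in>P. good_coeff c p d \<and> good_disc n c p d})"
    by (simp add: distrib_left right_diff_distrib)
  then show ?thesis using M by (simp add: pos_le_divide_eq mult.commute)
qed

text \<open>\<open>Y\<close> is so large that \<open>P\<close> contains all primes dividing
  \<open>n\<close> or \<open>c\<close>. The Euler product over \<open>P\<close> is then replaced
  from below by \<open>6 / pi^2\<close> in both terms.\<close>

lemma Bconst_le:
  assumes n: "n > 0" and c: "c \<noteq> 0" and Y: "n \<le> Y" "\<bar>c\<bar> \<le> int Y"
  defines "P \<equiv> {p. prime p \<and> p \<le> Y}"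
  shows "Bconst n c \<le> (\<Prod>p\<in>P. (1 - 1 / real p ^ 2) * (if int p dvd c then real p / (real p + 1) else 1))
      + (\<Prod>p\<in>P. if p dvd n then 1 else 1 - 1 / real p ^ 2) - 1"
proof -
  have P: "finite P" "\<And>p. p \<in> P \<Longrightarrow> prime p" by (auto simp: P_def)
  let ?e = "\<Prod>p\<in>P. 1 - 1 / real p ^ 2"
  have e: "6 / pi\<^sup>2 \<le> ?e" by (rule euler_product_bound[OF P])
  have pos: "1 - 1 / real p ^ 2 > 0" if "prime p" for p
    using prime_gt_1_nat[OF that] by (simp add: field_simps)
  have "(\<Prod>p\<in>prime_factors c. real_of_int p / (real_of_int p + 1)) = (\<Prod>p\<in>{p \<in> P. int p dvd c}. real p / (real p + 1))"
  proof (rule prod.reindex_bij_witness[of _ int nat])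
    fix p assume "p \<in> prime_factors c"
    then have p: "prime p" "p dvd c" by auto
    then have "p \<le> int Y" using dvd_imp_le_int[OF c p(2)] Y by linarith
    then show "nat p \<in> {p \<in> P. int p dvd c}" "int (nat p) = p"
      "real (nat p) / (real (nat p) + 1) = real_of_int p / (real_of_int p + 1)"
      using p prime_ge_0_int[OF p(1)] by (auto simp: P_def)
  next
    fix p assume "p \<in> {p \<in> P. int p dvd c}"
    then show "int p \<in> prime_factors c" using c by (auto simp: P_def in_prime_factors_iff)
  qed auto
  also have "\<dots> = (\<Prod>p\<in>P. if int p dvd c then real p / (real p + 1) else 1)"
    using P by (simp add: prod.inter_filter)
  finally have eq: "(\<Prod>p\<in>prime_factors c. real_of_int p / (real_of_int p + 1))
     = (\<Prod>p\<in>P. if int p dvd c then real p / (real p + 1) else 1)" .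
  have "6 / pi\<^sup>2 * (\<Prod>p\<in>prime_factors c. real_of_int p / (real_of_int p + 1))
     \<le> ?e * (\<Prod>p\<in>P. if int p dvd c then real p / (real p + 1) else 1)"
    unfolding eq by (rule mult_right_mono[OF e]) (rule prod_nonneg, simp)
  then have 1: "6 / pi\<^sup>2 * (\<Prod>p\<in>prime_factors c. real_of_int p / (real_of_int p + 1))
     \<le> (\<Prod>p\<in>P. (1 - 1 / real p ^ 2) * (if int p dvd c then real p / (real p + 1) else 1))"
    by (simp add: prod.distrib)
  have sub: "prime_factors n \<subseteq> P" using n Y by (auto simp: P_def dest!: dvd_imp_le)
  have F: "(\<Prod>p\<in>prime_factors n. (real p)\<^sup>2 / ((real p)\<^sup>2 - 1)) = inverse (\<Prod>p\<in>prime_factors n. 1 - 1 / real p ^ 2)"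
    unfolding prod_inversef[symmetric]
  proof (rule prod.cong)
    fix p assume "p \<in> prime_factors n"
    then have "prime p" by auto
    then have "real p > 0" using prime_gt_0_nat by simp
    then show "(real p)\<^sup>2 / ((real p)\<^sup>2 - 1) = (inverse \<circ> (\<lambda>p. 1 - 1 / (real p)\<^sup>2)) p"
      by (simp add: field_simps)
  qed simp
  have F0: "(\<Prod>p\<in>prime_factors n. 1 - 1 / real p ^ 2) > 0" by (intro prod_pos pos) auto
  have e_split: "?e = (\<Prod>p\<in>P - prime_factors n. 1 - 1 / real p ^ 2) * (\<Prod>p\<in>prime_factors n. 1 - 1 / real p ^ 2)"
    by (rule prod.subset_diff[OF sub P(1)])
  \<comment> \<open>The second product lacks the Euler factors at primes dividing \<open>n\<close>;
    the factors \<open>p^2 / (p^2 - 1)\<close> of \<open>Bconst\<close> cancel exactly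
    these.\<close>
  have "(\<Prod>p\<in>P - prime_factors n. 1 - 1 / real p ^ 2) = ?e * (\<Prod>p\<in>prime_factors n. (real p)\<^sup>2 / ((real p)\<^sup>2 - 1))"
    unfolding F e_split mult.assoc by (subst right_inverse) (use F0 in linarith, simp only: mult_1_right)
  also have "\<dots> \<ge> 6 / pi\<^sup>2 * (\<Prod>p\<in>prime_factors n. (real p)\<^sup>2 / ((real p)\<^sup>2 - 1))"
  proof (rule mult_right_mono[OF e])
    show "(\<Prod>p\<in>prime_factors n. (real p)\<^sup>2 / ((real p)\<^sup>2 - 1)) \<ge> 0"
      unfolding F using F0 by (intro order.strict_implies_order positive_imp_inverse_positive)
  qed
  also have "(\<Prod>p\<in>P - prime_factors n. 1 - 1 / real p ^ 2) = (\<Prod>p\<in>{p \<in> P. \<not> p dvd n}. 1 - 1 / real p ^ 2)"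
    using n by (intro prod.cong) (auto simp: P_def in_prime_factors_iff)
  also have "\<dots> = (\<Prod>p\<in>P. if \<not> p dvd n then 1 - 1 / real p ^ 2 else 1)"
    using P by (simp add: prod.inter_filter)
  also have "\<dots> = (\<Prod>p\<in>P. if p dvd n then 1 else 1 - 1 / real p ^ 2)" by (intro prod.cong) auto
  finally show ?thesis using 1 by (simp add: Bconst_def)
qed

text \<open>Primes up to \<open>Y\<close> are handled by \<open>good\<close>, larger ones by
  \<open>large\<close>; primes dividing \<open>c\<close> never exceed \<open>Y\<close>.\<close>

lemma monogenic_if_good:
  assumes n: "n > 2" and c: "squarefree c" "\<not> is_unit c" and Y: "\<bar>c\<bar> \<le> int Y"
    and good: "\<forall>p\<in>{p. prime p \<and> p \<le> Y}. good_coeff c p d \<and> good_disc n c p d"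
    and d0: "d \<noteq> 0"
    and large: "\<not> (\<exists>p>Y. int p ^ 2 dvd d)" "\<not> (\<exists>p>Y. coprime (int p) (int n ^ n) \<and> int p ^ 2 dvd disc_factor n c d)"
  shows "d \<in> monogenic_d n c"
proof -
  have c0: "c \<noteq> 0" using c by auto
  have nat_prime: "\<exists>q. p = int q \<and> prime q" if "prime p" for p :: int
    using that prime_ge_0_int by (intro exI[of _ "nat p"]) auto
  show ?thesis
  proof (rule monogenic_if_squarefree[OF n c])
    have "\<not> p\<^sup>2 dvd d" if p: "prime p" for p
    proof -
      obtain q where q: "p = int q" "prime q" using nat_prime[OF p] by blast
      show ?thesis using good large(1) q by (cases "q \<le> Y") (auto simp: good_coeff_def)
    qed
    then show "squarefree d" using d0 by (simp add: squarefree_factorial_semiring)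
    show "coprime c d"
    proof (rule ccontr)
      assume "\<not> coprime c d"
      then have "\<not> is_unit (gcd c d)" by (simp add: coprime_iff_gcd_eq_1)
      then obtain p where p: "prime p" "p dvd gcd c d" using prime_divisor_exists[of "gcd c d"] c0 by auto
      obtain q where q: "p = int q" "prime q" using nat_prime[OF p(1)] by blast
      have "int q dvd c" "int q dvd d" using p q by auto
      moreover have "q \<le> Y" using dvd_imp_le_int[OF c0 \<open>int q dvd c\<close>] Y by simp
      ultimately show False using good q by (auto simp: good_coeff_def)
    qed
    fix p :: int assume p: "prime p" "\<not> p dvd int n * c"
    obtain q where q: "p = int q" "prime q" using nat_prime[OF p(1)] by blast
    show "\<not> p\<^sup>2 dvd disc_factor n c d"
    proof (cases "q \<le> Y")
      case True
      then show ?thesis using good p q by (auto simp: good_disc_def)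
    next
      case False
      have "\<not> q dvd n" using p q by auto
      then have "coprime q n" using q by (simp add: prime_imp_coprime)
      then have "coprime (int q) (int n ^ n)" by simp
      then show ?thesis using False large(2) unfolding q(1) by (meson not_le)
    qed
  qed
qed

lemma finite_symmetric_interval: "finite {d. \<bar>d\<bar> \<le> int N \<and> Q d}"
  by (rule finite_subset[of _ "{- int N..int N}"]) auto

text \<open>Among the \<open>d\<close> that are good at all primes up to \<open>Y\<close>, the
  exceptions are those where \<open>d\<close> or \<open>disc_factor\<close> has a large square
  divisor, at most \<open>4 N / Y + 2 T\<close> many with \<open>T\<close> of order
  \<open>sqrt N\<close>, and at most two where one of these numbers vanishes.\<close>

lemma card_monogenic_ge:
  assumes n: "n > 2" and c: "squarefree c" "\<not> is_unit c" and Y: "n \<le> Y" "\<bar>c\<bar> \<le> int Y"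
  obtains C :: real where "\<And>N. real (card {d \<in> monogenic_d n c. \<bar>d\<bar> \<le> int N})
    \<ge> (2 * real N + 1) * Bconst n c - 4 * real N / real Y - C * sqrt (real N + 1)"
proof -
  define P where "P = {p. prime p \<and> p \<le> Y}"
  define M where "M = (\<Prod>p\<in>P. int p ^ 2)"
  define K where "K = int n ^ n"
  define e where "e = disc_factor n c 0"
  \<comment> \<open>\<open>L * (N + 1)\<close> bounds both \<open>N\<close> and
    \<open>K * N + \<bar>e\<bar>\<close>, so a single \<open>T\<close> near its square root serves
    both sieves.\<close>
  define L where "L = K + \<bar>e\<bar> + 1"
  define Q where "Q d \<longleftrightarrow> (\<forall>p\<in>P. good_coeff c p d \<and> good_disc n c p d)" for d
  \<comment> \<open>\<open>C\<close> absorbs \<open>2 * T\<close>, the incomplete period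
    \<open>M\<close> and the two exceptional values.\<close>
  define C where "C = 2 * (sqrt (of_int L) + 1) + of_int M + 2"
  have c0: "c \<noteq> 0" using c by auto
  have D: "disc_factor n c d = K * d + e" for d by (simp add: disc_factor_def K_def e_def)
  have K: "K > 0" using n by (simp add: K_def)
  have P: "finite P" "\<And>p. p \<in> P \<Longrightarrow> prime p" by (auto simp: P_def)
  have M: "M > 0" unfolding M_def using P prime_gt_0_nat by (intro prod_pos) auto
  have per: "Q (d mod M) = Q d" for d
  proof -
    have "good_coeff c p (d mod M) = good_coeff c p d \<and> good_disc n c p (d mod M) = good_disc n c p d" if "p \<in> P" for p
    proof -
      have "int p ^ 2 dvd M" unfolding M_def using P that by (intro dvd_prodI) auto
      then have "d mod M mod int p ^ 2 = d mod int p ^ 2" by (rule mod_mod_cancel)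
      then show ?thesis by (metis good_coeff_mod good_disc_mod)
    qed
    then show ?thesis by (simp add: Q_def)
  qed
  have dens: "Bconst n c \<le> real (card {d \<in> {0..<M}. Q d}) / of_int M"
    using Bconst_le[of n c Y] density_good_ge[OF P, of c n] n c0 Y
    unfolding Q_def M_def P_def by linarith
  have "(2 * real N + 1) * Bconst n c - 4 * real N / real Y - C * sqrt (real N + 1)
    \<le> real (card {d \<in> monogenic_d n c. \<bar>d\<bar> \<le> int N})" for N
  proof -
    define T where "T = nat \<lceil>sqrt (of_int L * (real N + 1))\<rceil>"
    have T1: "real T \<le> sqrt (of_int L * (real N + 1)) + 1" "sqrt (of_int L * (real N + 1)) \<le> real T"
      using K by (auto simp: T_def L_def of_nat_nat)
    have "of_int (L * (int N + 1)) \<le> real T ^ 2" using sqrt_le_D[OF T1(2)] by simp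
    then have T3: "L * (int N + 1) \<le> int T ^ 2"
      by (metis of_int_le_iff of_int_of_nat_eq of_int_power)
    have "K * int N + \<bar>e\<bar> \<le> L * (int N + 1)" "int N \<le> L * (int N + 1)"
      using K by (auto simp: L_def algebra_simps)
    then have "int N \<le> int T ^ 2" "K * int N + \<bar>e\<bar> \<le> int T ^ 2" using T3 by linarith+
    then have T: "\<bar>1\<bar> * int N + \<bar>0\<bar> \<le> int T ^ 2" "\<bar>K\<bar> * int N + \<bar>e\<bar> \<le> int T ^ 2"
      using K by (simp_all only: abs_one abs_zero mult_1 add_0_right abs_of_pos)
    have Y0: "Y > 0" using Y n by simp
    let ?X = "{d. \<bar>d\<bar> \<le> int N \<and> Q d}"
    let ?U = "\<lambda>K e. {d. \<bar>d\<bar> \<le> int N \<and> K * d + e \<noteq> 0 \<and> (\<exists>p>Y. coprime (int p) K \<and> int p ^ 2 dvd K * d + e)}"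
    \<comment> \<open>If \<open>K * d + e = 0\<close>, the division is exact and \<open>d\<close> is
      this quotient.\<close>
    let ?E = "{0, (- e) div K}"
    let ?S = "{d \<in> monogenic_d n c. \<bar>d\<bar> \<le> int N}"
    have "?X \<subseteq> ?S \<union> ?U 1 0 \<union> ?U K e \<union> ?E"
    proof
      fix d assume d: "d \<in> ?X"
      show "d \<in> ?S \<union> ?U 1 0 \<union> ?U K e \<union> ?E"
      proof (rule ccontr)
        assume nin: "d \<notin> ?S \<union> ?U 1 0 \<union> ?U K e \<union> ?E"
        have "K * d + e \<noteq> 0"
        proof
          assume "K * d + e = 0"
          then have "- e = K * d" by simp
          then have "(- e) div K = d" using K by simp
          then show False using nin by simp
        qed
        then have "d \<in> monogenic_d n c"
          using d nin by (intro monogenic_if_good[OF n c Y(2)]) (auto simp: Q_def P_def D K_def)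
        then show False using d nin by simp
      qed
    qed
    then have "card ?X \<le> card (?S \<union> ?U 1 0 \<union> ?U K e \<union> ?E)"
    proof (rule card_mono[rotated])
      have "?S = {d. \<bar>d\<bar> \<le> int N \<and> d \<in> monogenic_d n c}" by auto
      then have "finite ?S" by (simp only: finite_symmetric_interval)
      then show "finite (?S \<union> ?U 1 0 \<union> ?U K e \<union> ?E)"
        by (simp only: finite_Un finite_symmetric_interval) simp
    qed
    also have "\<dots> \<le> card ?S + card (?U 1 0) + card (?U K e) + card ?E"
      by (intro order.trans[OF card_Un_le] add_mono order.refl)
    also have "card ?E \<le> 2" using card_length[of "[0, (- e) div K]"] by simp
    finally have "real (card ?X) \<le> real (card ?S + card (?U 1 0) + card (?U K e) + 2)" by simp
    then have "real (card ?X) \<le> real (card ?S) + real (card (?U 1 0)) + real (card (?U K e)) + 2" by simp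
    moreover have "real (card (?U 1 0)) \<le> 2 * real N / real Y + real T"
      by (rule card_large_square_divisor_le[OF Y0 T(1)])
    moreover have "real (card (?U K e)) \<le> 2 * real N / real Y + real T"
      by (rule card_large_square_divisor_le[OF Y0 T(2)])
    moreover have "real (card ?X) \<ge> (2 * real N + 1) * (real (card {d \<in> {0..<M}. Q d}) / of_int M) - of_int M"
      by (rule card_periodic_symmetric_interval_ge[where Q = Q, OF M per])
    moreover have "(2 * real N + 1) * (real (card {d \<in> {0..<M}. Q d}) / of_int M) \<ge> (2 * real N + 1) * Bconst n c"
      by (rule mult_left_mono[OF dens]) simp
    moreover have "2 * real T + of_int M + 2 \<le> C * sqrt (real N + 1)"
    proof -
      have s: "sqrt (real N + 1) \<ge> 1" by simp
      have "2 * real T + of_int M + 2 \<le> 2 * (sqrt (of_int L) * sqrt (real N + 1) + 1) + of_int M + 2"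
        using T1(1) by (simp add: real_sqrt_mult)
      also have "\<dots> = 2 * sqrt (of_int L) * sqrt (real N + 1) + (4 + of_int M) * 1" by simp
      also have "\<dots> \<le> 2 * sqrt (of_int L) * sqrt (real N + 1) + (4 + of_int M) * sqrt (real N + 1)"
        using s M by (intro add_left_mono mult_left_mono) auto
      also have "\<dots> = C * sqrt (real N + 1)" by (simp add: C_def algebra_simps)
      finally show ?thesis .
    qed
    ultimately show ?thesis by linarith
  qed
  then show ?thesis by (rule that)
qed

text \<open>\<open>Y\<close> is fixed first, with \<open>4 / Y \<le> \<epsilon>\<close>, so that the
  linear error costs at most \<open>\<epsilon> / 2\<close>. Then \<open>C\<close>, which may depend
  on \<open>Y\<close>, is a constant, and the square root term is eventually below
  \<open>\<epsilon> / 2\<close>.\<close>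

lemma monogenic_density_ge:
  assumes n: "n > 2" and c: "squarefree c" "\<not> is_unit c" and \<epsilon>: "\<epsilon> > 0"
  shows "\<forall>\<^sub>F N in sequentially.
    real (card {d \<in> monogenic_d n c. \<bar>d\<bar> \<le> int N}) / (2 * real N + 1) \<ge> Bconst n c - \<epsilon>"
proof -
  define Y where "Y = max (max n (nat \<bar>c\<bar>)) (nat \<lceil>4 / \<epsilon>\<rceil>)"
  have Y: "n \<le> Y" "\<bar>c\<bar> \<le> int Y" by (auto simp: Y_def)
  have "4 / \<epsilon> \<le> real Y" unfolding Y_def by linarith
  moreover have "real Y > 0" using Y n by simp
  ultimately have Y\<epsilon>: "2 / real Y \<le> \<epsilon> / 2" using \<epsilon> by (simp add: field_simps)
  obtain C :: real where C: "\<And>N. real (card {d \<in> monogenic_d n c. \<bar>d\<bar> \<le> int N})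
    \<ge> (2 * real N + 1) * Bconst n c - 4 * real N / real Y - C * sqrt (real N + 1)"
    using card_monogenic_ge[OF n c Y] by blast
  have "(\<lambda>N. C * sqrt (real N + 1) / (2 * real N + 1)) \<longlonglongrightarrow> 0" by real_asymp
  then have "\<forall>\<^sub>F N in sequentially. C * sqrt (real N + 1) / (2 * real N + 1) < \<epsilon> / 2"
    using \<epsilon> by (intro order_tendstoD) auto
  then show ?thesis
  proof eventually_elim
    case (elim N)
    have p: "2 * real N + 1 > 0" by simp
    have "4 * real N / real Y = 2 * real N * (2 / real Y)" by simp
    also have "\<dots> \<le> (2 * real N + 1) * (\<epsilon> / 2)" using Y\<epsilon> by (intro mult_mono) auto
    finally have "4 * real N / real Y \<le> (2 * real N + 1) * (\<epsilon> / 2)" .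
    moreover have "C * sqrt (real N + 1) \<le> (2 * real N + 1) * (\<epsilon> / 2)"
      using elim p by (simp add: pos_divide_less_eq mult.commute)
    ultimately have "(2 * real N + 1) * Bconst n c - (2 * real N + 1) * (\<epsilon> / 2) - (2 * real N + 1) * (\<epsilon> / 2)
      \<le> real (card {d \<in> monogenic_d n c. \<bar>d\<bar> \<le> int N})" using C[of N] by linarith
    then have "(2 * real N + 1) * (Bconst n c - \<epsilon>) \<le> real (card {d \<in> monogenic_d n c. \<bar>d\<bar> \<le> int N})"
      by (simp add: algebra_simps)
    then show ?case using p by (simp add: pos_le_divide_eq mult.commute)
  qed
qed

section \<open>Positivity of \<open>Bconst\<close> and infinitude\<close>

lemma pi_squared_less_10: "pi\<^sup>2 < 10"
proof -
  have "pi < 3.15" using pi_approx(2) by simp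
  then have "pi\<^sup>2 < 3.15\<^sup>2" by (intro power_strict_mono) auto
  then show ?thesis by (simp add: power2_eq_square)
qed

text \<open>The product over the primes dividing \<open>n\<close> is at least 1, so
  \<open>Bconst\<close> is at least \<open>6 / pi^2 * (2/3 + 1) - 1 = 10 / pi^2 - 1\<close>,
  positive because \<open>pi^2 < 10\<close>.\<close>

lemma Bconst_pos:
  assumes "2 / 3 \<le> (\<Prod>p\<in>prime_factors c. real_of_int p / (real_of_int p + 1))"
  shows "Bconst n c > 0"
proof -
  have n: "1 \<le> (\<Prod>p\<in>prime_factors n. (real p)\<^sup>2 / ((real p)\<^sup>2 - 1))"
  proof (rule prod_ge_1)
    fix p assume "p \<in> prime_factors n"
    then have "prime p" by auto
    then have "1 < real p" using prime_gt_1_nat by simp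
    then have "(real p)\<^sup>2 > 1" by simp
    then show "1 \<le> (real p)\<^sup>2 / ((real p)\<^sup>2 - 1)" by (simp add: field_simps)
  qed
  have "6 / pi\<^sup>2 * (2 / 3) \<le> 6 / pi\<^sup>2 * (\<Prod>p\<in>prime_factors c. real_of_int p / (real_of_int p + 1))"
    by (rule mult_left_mono[OF assms]) simp
  moreover have "6 / pi\<^sup>2 * 1 \<le> 6 / pi\<^sup>2 * (\<Prod>p\<in>prime_factors n. (real p)\<^sup>2 / ((real p)\<^sup>2 - 1))"
    by (rule mult_left_mono[OF n]) simp
  moreover have "6 / pi\<^sup>2 * (2 / 3) + 6 / pi\<^sup>2 * 1 > 1"
    using pi_squared_less_10 by (simp add: field_simps)
  ultimately show ?thesis unfolding Bconst_def by linarith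
qed

text \<open>\<open>p / (p + 1)\<close> increases with \<open>p\<close>. A single prime gives at
  least 2/3, the value at 2; two primes that are at least 5 give at least 25/36.\<close>

lemma prod_prime_factors_ge:
  fixes c :: int
  assumes "card (prime_factors c) = 1 \<or> (card (prime_factors c) = 2 \<and> coprime c 6)"
  shows "2 / 3 \<le> (\<Prod>p\<in>prime_factors c. real_of_int p / (real_of_int p + 1))"
proof -
  have frac: "real_of_int k / (real_of_int k + 1) \<le> real_of_int p / (real_of_int p + 1)"
    if "0 < k" "k \<le> p" for k p :: int
    using that by (simp add: field_simps)
  show ?thesis using assms
  proof
    assume "card (prime_factors c) = 1"
    then obtain p where p: "prime_factors c = {p}" by (auto simp: card_1_singleton_iff)
    then have "p \<in> prime_factors c" by simp
    then have "prime p" by auto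
    then have "p \<ge> 2" by (rule prime_ge_2_int)
    then show ?thesis using frac[of 2 p] by (simp add: p)
  next
    assume c: "card (prime_factors c) = 2 \<and> coprime c 6"
    then obtain p q where pq: "prime_factors c = {p, q}" "p \<noteq> q" by (auto simp: card_2_iff)
    have ge: "5 / 6 \<le> real_of_int r / (real_of_int r + 1)" if "r \<in> prime_factors c" for r
    proof -
      have r: "prime r" "r dvd c" using that by auto
      have "\<not> r dvd 6" using r c by (meson coprime_common_divisor not_prime_unit)
      then have "r \<noteq> 2" "r \<noteq> 3" by auto
      moreover have "r \<noteq> 4"
      proof
        assume "r = 4"
        then have "(2 :: int) dvd r" by simp
        then have "(2 :: int) = r" using r primes_dvd_imp_eq[of 2 r] by simp
        then show False using \<open>r = 4\<close> by simp
      qed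
      moreover have "r \<ge> 2" using r by (intro prime_ge_2_int)
      ultimately have "r \<ge> 5" by linarith
      then show ?thesis using frac[of 5 r] by simp
    qed
    have ge': "5 / 6 \<le> real_of_int p / (real_of_int p + 1)" "5 / 6 \<le> real_of_int q / (real_of_int q + 1)"
      using ge[of p] ge[of q] pq by blast+
    have "5 / 6 * (5 / 6) \<le> real_of_int p / (real_of_int p + 1) * (real_of_int q / (real_of_int q + 1))"
      by (rule mult_mono[OF ge']) (use ge' in linarith)+
    moreover have "(\<Prod>p\<in>prime_factors c. real_of_int p / (real_of_int p + 1))
        = real_of_int p / (real_of_int p + 1) * (real_of_int q / (real_of_int q + 1))"
      using pq by simp
    ultimately show ?thesis by linarith
  qed
qed

text \<open>A finite set has proportion tending to 0, whereas eventually at least half of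
  \<open>Bconst\<close> is guaranteed.\<close>

lemma infinite_monogenic:
  assumes n: "n > 2" and c: "squarefree c" "\<not> is_unit c" and B: "Bconst n c > 0"
  shows "infinite (monogenic_d n c)"
proof
  assume fin: "finite (monogenic_d n c)"
  let ?K = "real (card (monogenic_d n c))"
  have "(\<lambda>N. ?K / (2 * real N + 1)) \<longlonglongrightarrow> 0" by real_asymp
  then have "\<forall>\<^sub>F N in sequentially. ?K / (2 * real N + 1) < Bconst n c / 2"
    using B by (intro order_tendstoD) auto
  moreover have "\<forall>\<^sub>F N in sequentially.
      real (card {d \<in> monogenic_d n c. \<bar>d\<bar> \<le> int N}) / (2 * real N + 1) \<ge> Bconst n c - Bconst n c / 2"
    using monogenic_density_ge[OF n c, of "Bconst n c / 2"] B by simp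
  ultimately have "\<forall>\<^sub>F N in sequentially. False"
  proof eventually_elim
    case (elim N)
    have "card {d \<in> monogenic_d n c. \<bar>d\<bar> \<le> int N} \<le> card (monogenic_d n c)"
      by (rule card_mono[OF fin]) auto
    then have "real (card {d \<in> monogenic_d n c. \<bar>d\<bar> \<le> int N}) / (2 * real N + 1) \<le> ?K / (2 * real N + 1)"
      by (intro divide_right_mono) auto
    then show ?case using elim by linarith
  qed
  then show False by simp
qed

theorem theorem3p6:
  fixes n :: nat and c :: int
  assumes "n > 2" and "c \<noteq> 0" and "squarefree c" and "c \<noteq> 1" and "c \<noteq> -1"
  shows "(\<forall>\<epsilon>>0. \<forall>\<^sub>F N in sequentially.
            real (card {d \<in> monogenic_d n c. \<bar>d\<bar> \<le> int N}) / (2 * real N + 1)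
              \<ge> Bconst n c - \<epsilon>)
       \<and> ((card (prime_factors c) = 1 \<or> (card (prime_factors c) = 2 \<and> coprime c 6))
            \<longrightarrow> Bconst n c > 0 \<and> infinite (monogenic_d n c))"
proof -
  have c: "\<not> is_unit c" using assms by auto
  show ?thesis
    using monogenic_density_ge[OF assms(1,3) c] infinite_monogenic[OF assms(1,3) c]
      Bconst_pos[OF prod_prime_factors_ge] by blast
qed

end
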